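(* Let $(M^\bullet,b,B)$ be a mixed cochain complex over a field $\mathbb{K}$ of characteristic zero, let $(\mathfrak{g}^\bullet,\delta,\{\cdot,\cdot\})$ be a dg-Lie algebra, and let $(\mathfrak{g}^\bullet,\iota,\mathcal{L},\mathcal{S},\mathcal{T})$ be a homotopy Cartan-Gerstenhaber calculus on $CC^\bullet_{\mathrm{per}}(M)$. Let $\zeta\in M^{-1}$ be a Palladio (duality) cocycle, and let $[\cdot,\cdot]$ be the induced graded Lie bracket on $HC^\bullet(M)$, i.e. the bracket obtained by transporting the Lie bracket of $H^\bullet(\mathfrak{g}^\bullet\ltimes CC^\bullet(M)[-2],\partial_{\hat\zeta})$ along the isomorphism $\Psi_{\hat\zeta}$, where $\hat\zeta\in CC^{-1}(M)$ is a $d_u$-cocycle whose value at $u=0$ is $b$-cohomologous to $\zeta$. Then for all homogeneous $z,w\in HC^\bullet(M)$ $$[z,w]=(-1)^{z-1}\,\beta\big((\pi z)\smile(\pi w)\big),$$ where $\pi\colon HC^\bullet(M)\to H^\bullet(M)$ and $\beta\colon H^\bullet(M)\to HC^{\bullet-1}(M)$ are the maps in Connes' long exact sequence and $\smile$ is the product on $H^\bullet(M)$ transported from $H^\bullet(\mathfrak{g})$ by $p_\zeta$.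
   Context: Mixed complexes. A mixed cochain complex $(M^\bullet,b,B)$ is a $\mathbb{Z}$-graded $\mathbb{K}$-vector space with $b$ of degree $+1$, $B$ of degree $-1$, $b^2=B^2=0$, $bB+Bb=0$; $H^\bullet(M)$ is the $b$-cohomology. $V[k]^i=V^{i+k}$. With $u$ of degree $2$, $M[[u,u^{-1}]]^n=\prod_{i+2j=n}M^iu^j$, $d_u=b+uB$; $CC^\bullet_{\mathrm{per}}(M)=(M[[u,u^{-1}]],d_u)$, and $CC^\bullet(M)=(M[[u]],d_u)$ is its subcomplex, with cohomology $HC^\bullet(M)$. The short exact sequence $0\to CC^\bullet(M)[-2]\xrightarrow{u}CC^\bullet(M)\xrightarrow{\mathrm{ev}_0}M^\bullet\to0$ gives the long exact sequence $\cdots\to HC^{n-2}(M)\to HC^n(M)\xrightarrow{\pi}H^n(M)\xrightarrow{\beta}HC^{n-1}(M)\to\cdots$; $\beta[m]=[Bm]$. $[P,Q]=PQ-(-1)^{|P||Q|}QP$ is the graded commutator, and in signs a homogeneous element denotes its degree. Calculus. A homotopy pre-Cartan calculus consists of linear maps $\iota\colon\mathfrak{g}^\bullet\otimes M^\bullet\to M^\bullet[1]$, $\mathcal{L}\colon\mathfrak{g}^\bullet\otimes M^\bullet\to M^\bullet$, $\mathcal{S}\colon\mathfrak{g}^\bullet\otimes M^\bullet\to M^\bullet[-1]$ with $\mathcal{L}_f=[B,\iota_f]+[b,\mathcal{S}_f]+\mathcal{S}_{\delta f}$, $[b,\iota_f]+\iota_{\delta f}=0$, $[B,\mathcal{S}_f]=0$.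 Everything is extended $\mathbb{K}[u,u^{-1}]$-linearly and $\mathcal{I}_f=\iota_f+u\mathcal{S}_f$. A homotopy Cartan calculus has in addition a linear map $\mathcal{T}\colon\mathfrak{g}^\bullet\otimes\mathfrak{g}^\bullet\otimes M^\bullet\to M^\bullet$ with $[\mathcal{I}_f,\mathcal{L}_g]-\mathcal{I}_{\{f,g\}}=[d_u,\mathcal{T}(f,g)]-\mathcal{T}(\delta f,g)-(-1)^f\mathcal{T}(f,\delta g)$. It is a homotopy Cartan-Gerstenhaber calculus if moreover $\mathcal{G}_{\mathfrak g}^\bullet=\mathfrak{g}^\bullet[-1]$ (so $\mathcal{G}^n_{\mathfrak g}=\mathfrak{g}^{n-1}$) carries a unital associative (not necessarily commutative) degree-$0$ product $\smile$ for which $\delta$ is a graded derivation, with $\iota_{f\smile g}=\iota_f\iota_g$ and $\iota_1=\mathrm{id}$. Palladio cocycle. $\zeta\in M^{-1}$ with (i) $b\zeta=0$; (ii) $B\zeta=b\eta$ for some $\eta\in M^{-3}$; (iii) $\mathfrak{g}^\bullet\to M^\bullet$, $f\mapsto(-1)^f\iota_f\zeta$, is a quasi-isomorphism. The induced isomorphism is $p_\zeta\colon H^\bullet(\mathfrak{g})\to H^\bullet(M)$, and $a\smile b:=p_\zeta(p_\zeta^{-1}(a)\smile p_\zeta^{-1}(b))$ on $H^\bullet(M)$. Induced bracket. A $d_u$-cocycle $\hat\zeta\in CC^{-1}(M)$ with $\mathrm{ev}_0\hat\zeta$ cohomologous to $\zeta$ exists. On $\mathfrak{g}^\bullet\oplus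 CC^\bullet(M)[-2]$ take the bracket $[(f,x),(g,y)]=(\{f,g\},\mathcal{L}_fy-(-1)^{gx}\mathcal{L}_gx)$ and differential $\partial_{\hat\zeta}(f,x)=(\delta f,d_ux+(-1)^f\mathcal{L}_f\hat\zeta)$; this is a dg-Lie algebra $\mathfrak{g}^\bullet\ltimes CC^\bullet(M)[-2]$. The map $\Psi_{\hat\zeta}(f,x)=(-1)^f\mathcal{I}_f\hat\zeta+ux$ to $CC^\bullet(M)$ is a quasi-isomorphism, and $[z,w]:=\Psi_{\hat\zeta}([\Psi_{\hat\zeta}^{-1}z,\Psi_{\hat\zeta}^{-1}w])$ on cohomology. *)

theory Defs
  imports Complex_Main "HOL-Library.Function_Algebras" "HOL-Library.Product_Plus"
begin

text \<open>
  A \<open>\<int>\<close>-graded vector space is a family of subspaces \<open>V i\<close>, in direct sum, of an ambient vector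
  space. The sum need not exhaust the ambient space, and axioms are imposed on homogeneous
  elements only; (multi)linear maps are taken to be defined on the ambient space, which over a
  field is no restriction.
\<close>

locale graded_space = vector_space scale
  for scale :: "'k::field \<Rightarrow> 'v::ab_group_add \<Rightarrow> 'v" +
  fixes V :: "int \<Rightarrow> 'v set"
  assumes subspace_component: "subspace (V i)"
    and independent_components:
      "finite I \<Longrightarrow> (\<And>i. i \<in> I \<Longrightarrow> x i \<in> V i) \<Longrightarrow> (\<Sum>i\<in>I. x i) = 0 \<Longrightarrow> i \<in> I \<Longrightarrow> x i = 0"

definition shift :: "(int \<Rightarrow> 'v set) \<Rightarrow> int \<Rightarrow> int \<Rightarrow> 'v set" where
  "shift V k = (\<lambda>i. V (i + k))"

text \<open>\<open>ksgn n x\<close> is \<open>(-1)\<^sup>n x\<close>.\<close>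

definition ksgn :: "int \<Rightarrow> 'v::ab_group_add \<Rightarrow> 'v" where
  "ksgn n x = (if even n then x else - x)"

text \<open>The graded commutator \<open>[P, Q]\<close> of operators \<open>P\<close>, \<open>Q\<close> of degrees \<open>p\<close>, \<open>q\<close>.\<close>

definition gcomm :: "int \<Rightarrow> int \<Rightarrow> ('v \<Rightarrow> 'v) \<Rightarrow> ('v \<Rightarrow> 'v) \<Rightarrow> 'v \<Rightarrow> 'v::ab_group_add" where
  "gcomm p q P Q x = P (Q x) - ksgn (p * q) (Q (P x))"

text \<open>
  Differentials and chain maps carry the degree of their argument, since the ones
  below involve signs depending on it.
\<close>

definition cocycles :: "(int \<Rightarrow> 'v set) \<Rightarrow> (int \<Rightarrow> 'v \<Rightarrow> 'v) \<Rightarrow> int \<Rightarrow> 'v::ab_group_add set" where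
  "cocycles C d n = {x \<in> C n. d n x = 0}"

definition coboundaries :: "(int \<Rightarrow> 'v set) \<Rightarrow> (int \<Rightarrow> 'v \<Rightarrow> 'v) \<Rightarrow> int \<Rightarrow> 'v::ab_group_add set" where
  "coboundaries C d n = d (n - 1) ` C (n - 1)"

definition cohomologous :: "(int \<Rightarrow> 'v set) \<Rightarrow> (int \<Rightarrow> 'v \<Rightarrow> 'v) \<Rightarrow> int \<Rightarrow> ('v::ab_group_add \<times> 'v) set" where
  "cohomologous C d n =
     {(x, y). x \<in> cocycles C d n \<and> y \<in> cocycles C d n \<and> x - y \<in> coboundaries C d n}"

definition cohomology :: "(int \<Rightarrow> 'v set) \<Rightarrow> (int \<Rightarrow> 'v \<Rightarrow> 'v) \<Rightarrow> int \<Rightarrow> 'v::ab_group_add set set" where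
  "cohomology C d n = cocycles C d n // cohomologous C d n"

definition coh_class :: "(int \<Rightarrow> 'v set) \<Rightarrow> (int \<Rightarrow> 'v \<Rightarrow> 'v) \<Rightarrow> int \<Rightarrow> 'v \<Rightarrow> 'v::ab_group_add set" where
  "coh_class C d n x = cohomologous C d n `` {x}"

text \<open>
  The map induced by \<open>f\<close> on cohomology classes, with values in degree \<open>n\<close> of the target: the union
  is over all representatives, hence equal to \<open>coh_class C' d' n (f x)\<close> for every representative
  \<open>x\<close> as soon as \<open>f\<close> descends to cohomology. Likewise for bilinear maps.
\<close>

definition coh_map ::
  "(int \<Rightarrow> 'w set) \<Rightarrow> (int \<Rightarrow> 'w \<Rightarrow> 'w) \<Rightarrow> int \<Rightarrow> ('v \<Rightarrow> 'w) \<Rightarrow> 'v set \<Rightarrow> 'w::ab_group_add set" where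
  "coh_map C' d' n f X = (\<Union>x\<in>X. coh_class C' d' n (f x))"

definition coh_map2 ::
  "(int \<Rightarrow> 'w set) \<Rightarrow> (int \<Rightarrow> 'w \<Rightarrow> 'w) \<Rightarrow> int \<Rightarrow> ('v \<Rightarrow> 'v \<Rightarrow> 'w) \<Rightarrow> 'v set \<Rightarrow> 'v set \<Rightarrow> 'w::ab_group_add set"
  where
  "coh_map2 C' d' n f X Y = (\<Union>x\<in>X. \<Union>y\<in>Y. coh_class C' d' n (f x y))"

text \<open>Only ever applied to maps that are linear by construction.\<close>

definition quasi_isomorphism ::
  "(int \<Rightarrow> 'v set) \<Rightarrow> (int \<Rightarrow> 'v \<Rightarrow> 'v) \<Rightarrow> (int \<Rightarrow> 'w set) \<Rightarrow> (int \<Rightarrow> 'w \<Rightarrow> 'w) \<Rightarrow>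
   (int \<Rightarrow> 'v::ab_group_add \<Rightarrow> 'w::ab_group_add) \<Rightarrow> bool" where
  "quasi_isomorphism C d C' d' f \<longleftrightarrow>
     (\<forall>n. \<forall>x\<in>C n. f n x \<in> C' n \<and> d' n (f n x) = f (n + 1) (d n x)) \<and>
     (\<forall>n. bij_betw (coh_map C' d' n (f n)) (cohomology C d n) (cohomology C' d' n))"

locale mixed_complex = graded_space scale M
  for scale :: "'k::field \<Rightarrow> 'm::ab_group_add \<Rightarrow> 'm" and M :: "int \<Rightarrow> 'm set" +
  fixes b B :: "'m \<Rightarrow> 'm"
  assumes b_linear: "Vector_Spaces.linear scale scale b"
    and B_linear: "Vector_Spaces.linear scale scale B"
    and b_degree: "x \<in> M n \<Longrightarrow> b x \<in> M (n + 1)"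
    and B_degree: "x \<in> M n \<Longrightarrow> B x \<in> M (n - 1)"
    and b_b: "x \<in> M n \<Longrightarrow> b (b x) = 0"
    and B_B: "x \<in> M n \<Longrightarrow> B (B x) = 0"
    and b_B: "x \<in> M n \<Longrightarrow> b (B x) + B (b x) = 0"

text \<open>
  A series \<open>\<Sum>\<^sub>j x\<^sub>j u\<^sup>j\<close> is the function \<open>j \<mapsto> x\<^sub>j\<close> on \<open>\<int>\<close>; \<open>CC\<close> consists of the series in
  \<open>CC_per\<close> without negative powers of \<open>u\<close>.
\<close>

definition CC_per :: "(int \<Rightarrow> 'm set) \<Rightarrow> int \<Rightarrow> (int \<Rightarrow> 'm) set" where
  "CC_per M n = {x. \<forall>j. x j \<in> M (n - 2 * j)}"

definition CC :: "(int \<Rightarrow> 'm::zero set) \<Rightarrow> int \<Rightarrow> (int \<Rightarrow> 'm) set" where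
  "CC M n = {x \<in> CC_per M n. \<forall>j<0. x j = 0}"

text \<open>Multiplication by \<open>u\<close>, and the \<open>u\<close>-linear extension of an operator.\<close>

definition umult :: "(int \<Rightarrow> 'm) \<Rightarrow> int \<Rightarrow> 'm" where
  "umult x = (\<lambda>j. x (j - 1))"

definition uext :: "('m \<Rightarrow> 'm) \<Rightarrow> (int \<Rightarrow> 'm) \<Rightarrow> int \<Rightarrow> 'm" where
  "uext P x = (\<lambda>j. P (x j))"

definition ev0 :: "(int \<Rightarrow> 'm) \<Rightarrow> 'm" where
  "ev0 x = x 0"

definition const_series :: "'m::zero \<Rightarrow> int \<Rightarrow> 'm" where
  "const_series m = (\<lambda>j. if j = 0 then m else 0)"

definition du :: "('m \<Rightarrow> 'm) \<Rightarrow> ('m \<Rightarrow> 'm) \<Rightarrow> (int \<Rightarrow> 'm) \<Rightarrow> int \<Rightarrow> 'm::ab_group_add" where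
  "du b B x = uext b x + umult (uext B x)"

abbreviation H_M :: "(int \<Rightarrow> 'm set) \<Rightarrow> ('m \<Rightarrow> 'm) \<Rightarrow> int \<Rightarrow> 'm::ab_group_add set set" where
  "H_M M b n \<equiv> cohomology M (\<lambda>_. b) n"

abbreviation HC ::
  "(int \<Rightarrow> 'm set) \<Rightarrow> ('m \<Rightarrow> 'm) \<Rightarrow> ('m \<Rightarrow> 'm) \<Rightarrow> int \<Rightarrow> (int \<Rightarrow> 'm::ab_group_add) set set" where
  "HC M b B n \<equiv> cohomology (CC M) (\<lambda>_. du b B) n"

definition connes_pi ::
  "(int \<Rightarrow> 'm set) \<Rightarrow> ('m \<Rightarrow> 'm) \<Rightarrow> int \<Rightarrow> (int \<Rightarrow> 'm) set \<Rightarrow> 'm::ab_group_add set" where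
  "connes_pi M b n = coh_map M (\<lambda>_. b) n ev0"

text \<open>
  The connecting map \<open>H\<^sup>n(M) \<rightarrow> HC\<^bsup>n-1\<^esup>(M)\<close> of
  \<open>0 \<rightarrow> CC(M)[-2] \<rightarrow> CC(M) \<rightarrow> M \<rightarrow> 0\<close>: lift a representative along \<open>ev0\<close>, apply the
  differential and divide by \<open>u\<close>. The set collects the results for all choices; by
  \<open>connes_beta_class\<close> below it is the class of \<open>B m\<close>, where \<open>m\<close> is any representative.
\<close>

definition connes_beta ::
  "(int \<Rightarrow> 'm set) \<Rightarrow> ('m \<Rightarrow> 'm) \<Rightarrow> ('m \<Rightarrow> 'm) \<Rightarrow> int \<Rightarrow> 'm set \<Rightarrow> (int \<Rightarrow> 'm::ab_group_add) set" where
  "connes_beta M b B n X =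
     {y \<in> cocycles (CC M) (\<lambda>_. du b B) (n - 1). \<exists>x\<in>CC M n. ev0 x \<in> X \<and> du b B x = umult y}"

locale dg_lie_algebra = graded_space scale G
  for scale :: "'k::field \<Rightarrow> 'g::ab_group_add \<Rightarrow> 'g" and G :: "int \<Rightarrow> 'g set" +
  fixes \<delta> :: "'g \<Rightarrow> 'g" and br :: "'g \<Rightarrow> 'g \<Rightarrow> 'g"
  assumes \<delta>_linear: "Vector_Spaces.linear scale scale \<delta>"
    and br_linear_left: "Vector_Spaces.linear scale scale (\<lambda>f. br f g)"
    and br_linear_right: "Vector_Spaces.linear scale scale (\<lambda>g. br f g)"
    and \<delta>_degree: "f \<in> G i \<Longrightarrow> \<delta> f \<in> G (i + 1)"
    and br_degree: "f \<in> G i \<Longrightarrow> g \<in> G j \<Longrightarrow> br f g \<in> G (i + j)"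
    and \<delta>_\<delta>: "f \<in> G i \<Longrightarrow> \<delta> (\<delta> f) = 0"
    and br_antisym: "f \<in> G i \<Longrightarrow> g \<in> G j \<Longrightarrow> br f g = - ksgn (i * j) (br g f)"
    and br_jacobi: "f \<in> G i \<Longrightarrow> g \<in> G j \<Longrightarrow> h \<in> G k \<Longrightarrow>
      br f (br g h) = br (br f g) h + ksgn (i * j) (br g (br f h))"
    and \<delta>_br: "f \<in> G i \<Longrightarrow> g \<in> G j \<Longrightarrow> \<delta> (br f g) = br (\<delta> f) g + ksgn i (br f (\<delta> g))"

text \<open>\<open>\<I>\<^sub>f = \<iota>\<^sub>f + u \<S>\<^sub>f\<close>, acting on series.\<close>

definition cartan_I ::
  "('g \<Rightarrow> 'm \<Rightarrow> 'm) \<Rightarrow> ('g \<Rightarrow> 'm \<Rightarrow> 'm) \<Rightarrow> 'g \<Rightarrow> (int \<Rightarrow> 'm) \<Rightarrow> int \<Rightarrow> 'm::ab_group_add" where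
  "cartan_I \<iota> S f x = uext (\<iota> f) x + umult (uext (S f) x)"

locale homotopy_pre_cartan_calculus =
  M: mixed_complex scaleM M b B + g: dg_lie_algebra scaleG G \<delta> br
  for scaleM :: "'k::field \<Rightarrow> 'm::ab_group_add \<Rightarrow> 'm" and M b B
    and scaleG :: "'k \<Rightarrow> 'g::ab_group_add \<Rightarrow> 'g" and G \<delta> br +
  fixes \<iota> L S :: "'g \<Rightarrow> 'm \<Rightarrow> 'm"
  assumes \<iota>_linear_left: "Vector_Spaces.linear scaleG scaleM (\<lambda>f. \<iota> f x)"
    and \<iota>_linear_right: "Vector_Spaces.linear scaleM scaleM (\<iota> f)"
    and L_linear_left: "Vector_Spaces.linear scaleG scaleM (\<lambda>f. L f x)"
    and L_linear_right: "Vector_Spaces.linear scaleM scaleM (L f)"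
    and S_linear_left: "Vector_Spaces.linear scaleG scaleM (\<lambda>f. S f x)"
    and S_linear_right: "Vector_Spaces.linear scaleM scaleM (S f)"
    and \<iota>_degree: "f \<in> G i \<Longrightarrow> x \<in> M n \<Longrightarrow> \<iota> f x \<in> shift M 1 (i + n)"
    and L_degree: "f \<in> G i \<Longrightarrow> x \<in> M n \<Longrightarrow> L f x \<in> M (i + n)"
    and S_degree: "f \<in> G i \<Longrightarrow> x \<in> M n \<Longrightarrow> S f x \<in> shift M (- 1) (i + n)"
    and L_eq: "f \<in> G i \<Longrightarrow> x \<in> M n \<Longrightarrow>
      L f x = gcomm (- 1) (i + 1) B (\<iota> f) x + gcomm 1 (i - 1) b (S f) x + S (\<delta> f) x"
    and b_\<iota>: "f \<in> G i \<Longrightarrow> x \<in> M n \<Longrightarrow> gcomm 1 (i + 1) b (\<iota> f) x + \<iota> (\<delta> f) x = 0"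
    and B_S: "f \<in> G i \<Longrightarrow> x \<in> M n \<Longrightarrow> gcomm (- 1) (i - 1) B (S f) x = 0"

locale homotopy_cartan_calculus =
  homotopy_pre_cartan_calculus scaleM M b B scaleG G \<delta> br \<iota> L S
  for scaleM :: "'k::field \<Rightarrow> 'm::ab_group_add \<Rightarrow> 'm" and M b B
    and scaleG :: "'k \<Rightarrow> 'g::ab_group_add \<Rightarrow> 'g" and G \<delta> br \<iota> L S +
  fixes T :: "'g \<Rightarrow> 'g \<Rightarrow> 'm \<Rightarrow> 'm"
  assumes T_linear1: "Vector_Spaces.linear scaleG scaleM (\<lambda>f. T f g x)"
    and T_linear2: "Vector_Spaces.linear scaleG scaleM (\<lambda>g. T f g x)"
    and T_linear3: "Vector_Spaces.linear scaleM scaleM (T f g)"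
    and T_degree: "f \<in> G i \<Longrightarrow> g \<in> G j \<Longrightarrow> x \<in> M n \<Longrightarrow> T f g x \<in> M (i + j + n)"
    and cartan_homotopy: "f \<in> G i \<Longrightarrow> g \<in> G j \<Longrightarrow> \<xi> \<in> CC_per M n \<Longrightarrow>
      gcomm (i + 1) j (cartan_I \<iota> S f) (uext (L g)) \<xi> - cartan_I \<iota> S (br f g) \<xi> =
      gcomm 1 (i + j) (du b B) (uext (T f g)) \<xi>
        - uext (T (\<delta> f) g) \<xi> - ksgn i (uext (T f (\<delta> g)) \<xi>)"

text \<open>
  The product is graded by \<open>shift G (- 1)\<close>, so its unit lies in \<open>G (- 1)\<close> and
  it has degree \<open>1\<close> with respect to \<open>G\<close>.
\<close>

locale homotopy_cartan_gerstenhaber_calculus =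
  homotopy_cartan_calculus scaleM M b B scaleG G \<delta> br \<iota> L S T
  for scaleM :: "'k::field \<Rightarrow> 'm::ab_group_add \<Rightarrow> 'm" and M b B
    and scaleG :: "'k \<Rightarrow> 'g::ab_group_add \<Rightarrow> 'g" and G \<delta> br \<iota> L S T +
  fixes cup :: "'g \<Rightarrow> 'g \<Rightarrow> 'g" and e :: 'g
  assumes cup_linear_left: "Vector_Spaces.linear scaleG scaleG (\<lambda>f. cup f g)"
    and cup_linear_right: "Vector_Spaces.linear scaleG scaleG (\<lambda>g. cup f g)"
    and cup_degree: "f \<in> shift G (- 1) p \<Longrightarrow> g \<in> shift G (- 1) q \<Longrightarrow> cup f g \<in> shift G (- 1) (p + q)"
    and unit_degree: "e \<in> shift G (- 1) 0"
    and cup_assoc: "f \<in> shift G (- 1) p \<Longrightarrow> g \<in> shift G (- 1) q \<Longrightarrow> h \<in> shift G (- 1) r \<Longrightarrow>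
      cup (cup f g) h = cup f (cup g h)"
    and unit_left: "f \<in> shift G (- 1) p \<Longrightarrow> cup e f = f"
    and unit_right: "f \<in> shift G (- 1) p \<Longrightarrow> cup f e = f"
    and \<delta>_cup: "f \<in> shift G (- 1) p \<Longrightarrow> g \<in> shift G (- 1) q \<Longrightarrow>
      \<delta> (cup f g) = cup (\<delta> f) g + ksgn p (cup f (\<delta> g))"
    and \<iota>_cup: "f \<in> shift G (- 1) p \<Longrightarrow> g \<in> shift G (- 1) q \<Longrightarrow> x \<in> M n \<Longrightarrow>
      \<iota> (cup f g) x = \<iota> f (\<iota> g x)"
    and \<iota>_unit: "x \<in> M n \<Longrightarrow> \<iota> e x = x"

definition palladio_map :: "('g \<Rightarrow> 'm \<Rightarrow> 'm) \<Rightarrow> 'm \<Rightarrow> int \<Rightarrow> 'g \<Rightarrow> 'm::ab_group_add" where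
  "palladio_map \<iota> \<zeta> i f = ksgn i (\<iota> f \<zeta>)"

definition palladio_cocycle ::
  "(int \<Rightarrow> 'm set) \<Rightarrow> ('m \<Rightarrow> 'm) \<Rightarrow> ('m \<Rightarrow> 'm) \<Rightarrow> (int \<Rightarrow> 'g set) \<Rightarrow> ('g \<Rightarrow> 'g) \<Rightarrow>
   ('g::ab_group_add \<Rightarrow> 'm \<Rightarrow> 'm) \<Rightarrow> 'm::ab_group_add \<Rightarrow> bool" where
  "palladio_cocycle M b B G \<delta> \<iota> \<zeta> \<longleftrightarrow>
     \<zeta> \<in> M (- 1) \<and> b \<zeta> = 0 \<and> (\<exists>\<eta>\<in>M (- 3). B \<zeta> = b \<eta>) \<and>
     quasi_isomorphism G (\<lambda>_. \<delta>) M (\<lambda>_. b) (palladio_map \<iota> \<zeta>)"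

definition palladio_iso ::
  "(int \<Rightarrow> 'm set) \<Rightarrow> ('m \<Rightarrow> 'm) \<Rightarrow> ('g \<Rightarrow> 'm \<Rightarrow> 'm) \<Rightarrow> 'm \<Rightarrow> int \<Rightarrow> 'g set \<Rightarrow> 'm::ab_group_add set" where
  "palladio_iso M b \<iota> \<zeta> n = coh_map M (\<lambda>_. b) n (palladio_map \<iota> \<zeta> n)"

text \<open>
  The product of classes of degrees \<open>m\<close>, \<open>n\<close> in the cohomology of \<open>M\<close>; it has degree \<open>m + n + 1\<close>
  because the product on \<open>G\<close> raises degrees by one.
\<close>

definition palladio_cup ::
  "(int \<Rightarrow> 'm set) \<Rightarrow> ('m \<Rightarrow> 'm) \<Rightarrow> (int \<Rightarrow> 'g set) \<Rightarrow> ('g \<Rightarrow> 'g) \<Rightarrow> ('g \<Rightarrow> 'm \<Rightarrow> 'm) \<Rightarrow>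
   ('g \<Rightarrow> 'g \<Rightarrow> 'g::ab_group_add) \<Rightarrow> 'm \<Rightarrow> int \<Rightarrow> int \<Rightarrow> 'm set \<Rightarrow> 'm set \<Rightarrow> 'm::ab_group_add set" where
  "palladio_cup M b G \<delta> \<iota> cup \<zeta> m n X Y =
     palladio_iso M b \<iota> \<zeta> (m + n + 1)
       (coh_map2 G (\<lambda>_. \<delta>) (m + n + 1) cup
          (inv_into (cohomology G (\<lambda>_. \<delta>) m) (palladio_iso M b \<iota> \<zeta> m) X)
          (inv_into (cohomology G (\<lambda>_. \<delta>) n) (palladio_iso M b \<iota> \<zeta> n) Y))"

definition semidirect ::
  "(int \<Rightarrow> 'm set) \<Rightarrow> (int \<Rightarrow> 'g set) \<Rightarrow> int \<Rightarrow> ('g \<times> (int \<Rightarrow> 'm::ab_group_add)) set" where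
  "semidirect M G n = G n \<times> shift (CC M) (- 2) n"

definition semidirect_diff ::
  "('m \<Rightarrow> 'm) \<Rightarrow> ('m \<Rightarrow> 'm) \<Rightarrow> ('g \<Rightarrow> 'g) \<Rightarrow> ('g \<Rightarrow> 'm \<Rightarrow> 'm) \<Rightarrow> (int \<Rightarrow> 'm) \<Rightarrow> int \<Rightarrow>
   'g \<times> (int \<Rightarrow> 'm) \<Rightarrow> 'g \<times> (int \<Rightarrow> 'm::ab_group_add)" where
  "semidirect_diff b B \<delta> L \<zeta>h i = (\<lambda>(f, x). (\<delta> f, du b B x + ksgn i (uext (L f) \<zeta>h)))"

text \<open>
  The arguments have total degrees \<open>i\<close>, \<open>j\<close>; the sign does not depend on whether the degree of
  \<open>x\<close> is taken in \<open>CC(M)\<close> or in \<open>CC(M)[-2]\<close>.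
\<close>

definition semidirect_bracket ::
  "('g \<Rightarrow> 'g \<Rightarrow> 'g) \<Rightarrow> ('g \<Rightarrow> 'm \<Rightarrow> 'm) \<Rightarrow> int \<Rightarrow> int \<Rightarrow>
   'g \<times> (int \<Rightarrow> 'm) \<Rightarrow> 'g \<times> (int \<Rightarrow> 'm) \<Rightarrow> 'g \<times> (int \<Rightarrow> 'm::ab_group_add)" where
  "semidirect_bracket br L i j =
     (\<lambda>(f, x) (g, y). (br f g, uext (L f) y - ksgn (j * i) (uext (L g) x)))"

definition Psi ::
  "('g \<Rightarrow> 'm \<Rightarrow> 'm) \<Rightarrow> ('g \<Rightarrow> 'm \<Rightarrow> 'm) \<Rightarrow> (int \<Rightarrow> 'm) \<Rightarrow> int \<Rightarrow>
   'g \<times> (int \<Rightarrow> 'm) \<Rightarrow> int \<Rightarrow> 'm::ab_group_add" where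
  "Psi \<iota> S \<zeta>h i = (\<lambda>(f, x). ksgn i (cartan_I \<iota> S f \<zeta>h) + umult x)"

definition Psi_iso ::
  "(int \<Rightarrow> 'm set) \<Rightarrow> ('m \<Rightarrow> 'm) \<Rightarrow> ('m \<Rightarrow> 'm) \<Rightarrow> ('g \<Rightarrow> 'm \<Rightarrow> 'm) \<Rightarrow> ('g \<Rightarrow> 'm \<Rightarrow> 'm) \<Rightarrow> (int \<Rightarrow> 'm) \<Rightarrow>
   int \<Rightarrow> ('g \<times> (int \<Rightarrow> 'm)) set \<Rightarrow> (int \<Rightarrow> 'm::ab_group_add) set" where
  "Psi_iso M b B \<iota> S \<zeta>h n = coh_map (CC M) (\<lambda>_. du b B) n (Psi \<iota> S \<zeta>h n)"

text \<open>The bracket of classes of degrees \<open>m\<close>, \<open>n\<close> in \<open>HC\<close>.\<close>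

definition HC_bracket ::
  "(int \<Rightarrow> 'm set) \<Rightarrow> ('m \<Rightarrow> 'm) \<Rightarrow> ('m \<Rightarrow> 'm) \<Rightarrow> (int \<Rightarrow> 'g::ab_group_add set) \<Rightarrow> ('g \<Rightarrow> 'g) \<Rightarrow> ('g \<Rightarrow> 'g \<Rightarrow> 'g) \<Rightarrow>
   ('g \<Rightarrow> 'm \<Rightarrow> 'm) \<Rightarrow> ('g \<Rightarrow> 'm \<Rightarrow> 'm) \<Rightarrow> ('g \<Rightarrow> 'm \<Rightarrow> 'm) \<Rightarrow> (int \<Rightarrow> 'm) \<Rightarrow> int \<Rightarrow> int \<Rightarrow>
   (int \<Rightarrow> 'm) set \<Rightarrow> (int \<Rightarrow> 'm) set \<Rightarrow> (int \<Rightarrow> 'm::ab_group_add) set" where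
  "HC_bracket M b B G \<delta> br \<iota> L S \<zeta>h m n z w =
     (let C = semidirect M G; d = semidirect_diff b B \<delta> L \<zeta>h; \<Psi> = Psi_iso M b B \<iota> S \<zeta>h
      in \<Psi> (m + n)
           (coh_map2 C d (m + n) (semidirect_bracket br L m n)
              (inv_into (cohomology C d m) (\<Psi> m) z)
              (inv_into (cohomology C d n) (\<Psi> n) w)))"

text \<open>The class \<open>(-1)\<^sup>k z\<close> for \<open>z\<close> in \<open>HC\<close> of degree \<open>n\<close>.\<close>

definition HC_sign ::
  "(int \<Rightarrow> 'm set) \<Rightarrow> ('m \<Rightarrow> 'm) \<Rightarrow> ('m \<Rightarrow> 'm) \<Rightarrow> int \<Rightarrow> int \<Rightarrow> (int \<Rightarrow> 'm) set \<Rightarrow>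
   (int \<Rightarrow> 'm::ab_group_add) set" where
  "HC_sign M b B n k z = coh_map (CC M) (\<lambda>_. du b B) n (ksgn k) z"

context mixed_complex
begin

lemma const_series_cocycle:
  assumes "m \<in> cocycles M (\<lambda>_. b) n"
  shows "const_series (B m) \<in> cocycles (CC M) (\<lambda>_. du b B) (n - 1)"
proof -
  have m: "m \<in> M n" "b m = 0" using assms by (auto simp: cocycles_def)
  have b0: "b 0 = 0" and B0: "B 0 = 0"
    using b_linear B_linear
    by (auto simp: Vector_Spaces.linear_iff_module_hom module_hom.zero)
  have "b (B m) = 0" using b_B[OF m(1)] m(2) B0 by simp
  moreover have "0 \<in> M k" for k
    using subspace_component[of k] by (rule subspace_0)
  ultimately show ?thesis
    using B_degree[OF m(1)] B_B[OF m(1)] b0 B0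
    by (auto simp: cocycles_def CC_def CC_per_def const_series_def du_def uext_def umult_def
        fun_eq_iff)
qed

lemma connes_beta_class:
  assumes m: "m \<in> cocycles M (\<lambda>_. b) n"
  shows "connes_beta M b B n (coh_class M (\<lambda>_. b) n m)
       = coh_class (CC M) (\<lambda>_. du b B) (n - 1) (const_series (B m))"
    (is "?l = ?r")
proof -
  have b_add: "b (x + y) = b x + b y" and B_add: "B (x + y) = B x + B y" for x y
    using b_linear B_linear
    by (auto simp: Vector_Spaces.linear_iff_module_hom module_hom.add)
  have b_diff: "b (x - y) = b x - b y" and B_diff: "B (x - y) = B x - B y" for x y
    using b_linear B_linear
    by (auto simp: Vector_Spaces.linear_iff_module_hom module_hom.diff)
  have b0: "b 0 = 0" and B0: "B 0 = 0"
    using b_diff[of 0 0] B_diff[of 0 0] by auto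
  have M0: "0 \<in> M k" for k
    using subspace_component[of k] by (rule subspace_0)
  have M_add: "x + y \<in> M k" if "x \<in> M k" "y \<in> M k" for x y k
    using subspace_component[of k] that by (rule subspace_add)
  have M_diff: "x - y \<in> M k" if "x \<in> M k" "y \<in> M k" for x y k
    using subspace_component[of k] that by (rule subspace_diff)
  have mM: "m \<in> M n" "b m = 0" using m by (auto simp: cocycles_def)
  note Bm = const_series_cocycle[OF m]
  have CC_D: "x j \<in> M (k - 2 * j)" "j < 0 \<Longrightarrow> x j = 0" if "x \<in> CC M k" for x k j
    using that by (auto simp: CC_def CC_per_def)
  show ?thesis
  proof (intro equalityI subsetI)
    fix y assume "y \<in> ?l"
    then obtain x where y: "y \<in> cocycles (CC M) (\<lambda>_. du b B) (n - 1)"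
      and x: "x \<in> CC M n" "ev0 x \<in> coh_class M (\<lambda>_. b) n m" "du b B x = umult y"
      by (auto simp: connes_beta_def)
    from x(2) obtain k where k: "k \<in> M (n - 1)" "m - x 0 = b k"
      by (auto simp: coh_class_def cohomologous_def coboundaries_def ev0_def)
    have x0: "x 0 = m - b k" using k(2) by (metis diff_diff_eq2 diff_add_cancel add_diff_cancel_left')
    define v where "v = (\<lambda>j. if j = 0 then - B k - x 1 else if j < 0 then 0 else - x (j + 1))"
    have "v \<in> CC M (n - 1 - 1)"
    proof -
      have "v j \<in> M (n - 1 - 1 - 2 * j)" for j
        using CC_D(1)[OF x(1), of "j + 1"] CC_D(1)[OF x(1), of 1] B_degree[OF k(1)] M0
          M_diff[of 0 "n - 1 - 1 - 2 * j" "x (j + 1)"] M_diff[of "- B k" "n - 2" "x 1"] M_diff[of 0 "n - 2" "B k"]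
        by (auto simp: v_def algebra_simps)
      then show ?thesis by (auto simp: CC_def CC_per_def v_def)
    qed
    moreover have "const_series (B m) - y = du b B v"
    proof
      fix j :: int
      have e: "y j = b (x (j + 1)) + B (x j)"
        using fun_cong[OF x(3), of "j + 1"] by (simp add: du_def uext_def umult_def)
      have bBk: "b (B k) = - B (b k)" using b_B[OF k(1)] by (simp add: eq_neg_iff_add_eq_0)
      consider "j < 0" | "j = 0" | "j = 1" | "j > 1" by linarith
      then show "(const_series (B m) - y) j = du b B v j"
      proof cases
        case 1
        have "y j = 0" using y 1 by (auto simp: cocycles_def dest: CC_D(2))
        then show ?thesis using 1
          by (simp add: const_series_def du_def uext_def umult_def v_def b0 B0)
      next
        case 2
        show ?thesis unfolding fun_diff_def e using 2 x0 bBk b_diff[of 0 "B k"]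
          by (simp add: const_series_def du_def uext_def umult_def v_def b_diff B_diff b0 B0)
      next
        case 3
        have "B (B k) = 0" by (rule B_B[OF k(1)])
        then show ?thesis unfolding fun_diff_def e using 3 b_diff[of 0 "x 2"] B_diff[of 0 "B k"]
          by (simp add: const_series_def du_def uext_def umult_def v_def b_diff B_diff b0 B0)
      next
        case 4
        then show ?thesis unfolding fun_diff_def e using b_diff[of 0 "x (j + 1)"] B_diff[of 0 "x j"]
          by (simp add: const_series_def du_def uext_def umult_def v_def b0 B0)
      qed
    qed
    ultimately show "y \<in> ?r" using y Bm
      by (auto simp: coh_class_def cohomologous_def coboundaries_def)
  next
    fix y assume "y \<in> ?r"
    then obtain v where y: "y \<in> cocycles (CC M) (\<lambda>_. du b B) (n - 1)"
      and v: "v \<in> CC M (n - 1 - 1)" "const_series (B m) - y = du b B v"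
      by (auto simp: coh_class_def cohomologous_def coboundaries_def)
    define x where "x = const_series m - umult v"
    have v0: "v j = 0" if "j < 0" for j using CC_D(2)[OF v(1) that] .
    have "x \<in> CC M n"
    proof -
      have "x j \<in> M (n - 2 * j)" for j
        using CC_D(1)[OF v(1), of "j - 1"] mM M0[of "n - 2 * j"] M_diff[of _ "n - 2 * j"]
        by (auto simp: x_def const_series_def umult_def algebra_simps)
      then show ?thesis by (auto simp: CC_def CC_per_def x_def const_series_def umult_def v0)
    qed
    moreover have "ev0 x \<in> coh_class M (\<lambda>_. b) n m"
      using m M0[of "n - 1"] b0 v0[of "-1"]
      by (force simp: ev0_def x_def const_series_def umult_def coh_class_def cohomologous_def
          coboundaries_def)
    moreover have "du b B x = umult y"
    proof
      fix j :: int
      have "y (j - 1) = const_series (B m) (j - 1) - (b (v (j - 1)) + B (v (j - 2)))"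
        using fun_cong[OF v(2), of "j - 1"]
        by (simp add: du_def uext_def umult_def algebra_simps)
      then show "du b B x j = umult y j"
        using mM b_diff[of 0] B_diff[of 0]
        by (auto simp: du_def uext_def umult_def x_def const_series_def b_diff B_diff b0 B0)
    qed
    ultimately show "y \<in> ?l" using y by (auto simp: connes_beta_def)
  qed
qed

end

end

theory Submission
  imports Defs
begin

text \<open>
  Let \<open>(f, x)\<close> and \<open>(g, y)\<close> be cocycles of the semidirect product, and \<open>W\<close> the image of
  \<open>(g, y)\<close> under \<open>\<Psi>\<close>. The Cartan homotopy formula for the pair \<open>(g, f)\<close>, evaluated at \<open>\<zeta>h\<close>, shows that the image
  of their bracket is cohomologous to \<open>\<L>\<^sub>f W\<close>. Since \<open>[d\<^sub>u, \<I>\<^sub>f] = u \<L>\<^sub>f\<close> for closed \<open>f\<close>, the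
  series \<open>\<I>\<^sub>f W\<close> lifts \<open>\<iota>\<^sub>f W\<^sub>0\<close> along \<open>ev0\<close> and has differential \<open>u \<L>\<^sub>f W\<close>, so \<open>[\<L>\<^sub>f W]\<close> is the value
  of Connes' connecting map at \<open>[\<iota>\<^sub>f W\<^sub>0] = \<plusminus>[\<iota>\<^sub>f \<iota>\<^sub>g \<zeta>] = \<plusminus>[\<iota>\<^bsub>f \<smile> g\<^esub> \<zeta>]\<close>. The product
  need not be graded commutative: the factors come out in the right order because antisymmetry of the
  bracket was used to pass from \<open>(f, g)\<close> to \<open>(g, f)\<close>.
\<close>

section \<open>Cochain complexes and maps induced on cohomology classes\<close>

locale cochain_complex =
  fixes C :: "int \<Rightarrow> 'v::ab_group_add set" and d :: "int \<Rightarrow> 'v \<Rightarrow> 'v"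
  assumes zero_closed: "0 \<in> C n"
    and diff_closed: "x \<in> C n \<Longrightarrow> y \<in> C n \<Longrightarrow> x - y \<in> C n"
    and d_closed: "x \<in> C n \<Longrightarrow> d n x \<in> C (n + 1)"
    and d_diff: "x \<in> C n \<Longrightarrow> y \<in> C n \<Longrightarrow> d n (x - y) = d n x - d n y"
    and d_d: "x \<in> C n \<Longrightarrow> d (n + 1) (d n x) = 0"
begin

lemma neg_closed: "x \<in> C n \<Longrightarrow> - x \<in> C n"
  using diff_closed[OF zero_closed] by (metis diff_0)

lemma add_closed: "x \<in> C n \<Longrightarrow> y \<in> C n \<Longrightarrow> x + y \<in> C n"
  using diff_closed[OF _ neg_closed] by (metis diff_minus_eq_add)

lemma ksgn_closed: "x \<in> C n \<Longrightarrow> ksgn k x \<in> C n"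
  by (simp add: ksgn_def neg_closed)

lemma d_zero: "d n 0 = 0"
  using d_diff[OF zero_closed zero_closed] by simp

lemma d_neg: "x \<in> C n \<Longrightarrow> d n (- x) = - d n x"
  using d_diff[OF zero_closed] by (metis d_zero diff_0)

lemma d_add: "x \<in> C n \<Longrightarrow> y \<in> C n \<Longrightarrow> d n (x + y) = d n x + d n y"
  using d_diff[OF _ neg_closed] d_neg by (metis diff_minus_eq_add)

lemma coboundary: "y \<in> C (n - 1) \<Longrightarrow> d (n - 1) y \<in> coboundaries C d n"
  by (simp add: coboundaries_def)

lemma coboundary_is_cocycle: "x \<in> coboundaries C d n \<Longrightarrow> x \<in> cocycles C d n"
  using d_closed[of _ "n - 1"] d_d[of _ "n - 1"] by (auto simp: coboundaries_def cocycles_def)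

lemma coboundary_neg: "x \<in> coboundaries C d n \<Longrightarrow> - x \<in> coboundaries C d n"
  using neg_closed d_neg[symmetric] by (auto simp: coboundaries_def)

lemma coboundary_ksgn: "x \<in> coboundaries C d n \<Longrightarrow> ksgn k x \<in> coboundaries C d n"
  by (simp add: ksgn_def coboundary_neg)

lemma coboundary_add:
  "x \<in> coboundaries C d n \<Longrightarrow> y \<in> coboundaries C d n \<Longrightarrow> x + y \<in> coboundaries C d n"
  using add_closed d_add[symmetric] by (auto simp: coboundaries_def)

lemma cocycle_add:
  "x \<in> cocycles C d n \<Longrightarrow> y \<in> cocycles C d n \<Longrightarrow> x + y \<in> cocycles C d n"
  by (simp add: cocycles_def add_closed d_add)

lemma cocycle_neg: "x \<in> cocycles C d n \<Longrightarrow> - x \<in> cocycles C d n"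
  by (simp add: cocycles_def neg_closed d_neg)

text \<open>A coboundary is a cocycle, so \<open>x\<close> is a sum of two cocycles and needs no
  check of its own.\<close>

lemma cohomologousI:
  assumes "y \<in> cocycles C d n" "x - y \<in> coboundaries C d n"
  shows "(x, y) \<in> cohomologous C d n"
  using assms cocycle_add[OF assms(1) coboundary_is_cocycle[OF assms(2)]]
  by (simp add: cohomologous_def)

lemma equiv_cohomologous: "equiv (cocycles C d n) (cohomologous C d n)"
proof (rule equivI)
  show "refl_on (cocycles C d n) (cohomologous C d n)"
    using coboundary[OF zero_closed] by (auto simp: refl_on_def cohomologous_def d_zero)
  show "sym (cohomologous C d n)"
    using coboundary_neg by (fastforce simp: sym_def cohomologous_def)
  show "trans (cohomologous C d n)"
    using coboundary_add by (fastforce simp: trans_def cohomologous_def)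
  show "cohomologous C d n \<subseteq> cocycles C d n \<times> cocycles C d n"
    by (auto simp: cohomologous_def)
qed

lemma cohomologous_sym:
  "(x, y) \<in> cohomologous C d n \<Longrightarrow> (y, x) \<in> cohomologous C d n"
  using equiv_cohomologous by (meson equivE symD)

lemma cohomologous_ksgn:
  "(x, y) \<in> cohomologous C d n \<Longrightarrow> (ksgn k x, ksgn k y) \<in> cohomologous C d n"
  using coboundary_neg[of "x - y"] by (auto simp: ksgn_def cohomologous_def cocycle_neg)

lemma cohomologous_refl: "x \<in> cocycles C d n \<Longrightarrow> (x, x) \<in> cohomologous C d n"
  using equiv_cohomologous by (meson equivE refl_onD)

lemma cohomologous_cocycle:
  "(x, y) \<in> cohomologous C d n \<Longrightarrow> x \<in> cocycles C d n"
  "(x, y) \<in> cohomologous C d n \<Longrightarrow> y \<in> cocycles C d n"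
  by (auto simp: cohomologous_def)

lemma in_own_class: "x \<in> cocycles C d n \<Longrightarrow> x \<in> coh_class C d n x"
  unfolding coh_class_def using equiv_cohomologous by (rule equiv_class_self)

lemma class_eqI: "(x, y) \<in> cohomologous C d n \<Longrightarrow> coh_class C d n x = coh_class C d n y"
  unfolding coh_class_def using equiv_cohomologous by (rule equiv_class_eq)

lemma class_in_cohomology: "x \<in> cocycles C d n \<Longrightarrow> coh_class C d n x \<in> cohomology C d n"
  by (simp add: coh_class_def cohomology_def quotientI)

lemma mem_classD:
  assumes "y \<in> coh_class C d n x"
  shows "(x, y) \<in> cohomologous C d n" "x \<in> cocycles C d n" "y \<in> cocycles C d n"
    "coh_class C d n x = coh_class C d n y"
  using assms class_eqI by (auto simp: coh_class_def cohomologous_def)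

lemma cohomology_cases:
  assumes "X \<in> cohomology C d n"
  obtains x where "x \<in> cocycles C d n" "X = coh_class C d n x"
  using assms by (auto simp: cohomology_def coh_class_def elim: quotientE)

lemma cohomology_nonempty: "X \<in> cohomology C d n \<Longrightarrow> X \<noteq> {}"
  using in_own_class by (auto elim!: cohomology_cases)

lemma mem_cohomologyD:
  assumes "X \<in> cohomology C d n" "x \<in> X"
  shows "x \<in> cocycles C d n" "X = coh_class C d n x"
proof -
  obtain y where "X = coh_class C d n y"
    using assms(1) by (rule cohomology_cases)
  then show "x \<in> cocycles C d n" "X = coh_class C d n x"
    using mem_classD(3,4)[of x n y] assms(2) by simp_all
qed

end

text \<open>\<open>coh_map\<close> is a union over all representatives. Its members coincide because
  \<open>f\<close> respects cohomologous elements, and the index set is nonempty because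
  \<open>x\<close> lies in its own class.\<close>

lemma coh_map_class:
  assumes "cochain_complex C d" "cochain_complex C' d'"
    and "\<And>y. (x, y) \<in> cohomologous C d n \<Longrightarrow> (f x, f y) \<in> cohomologous C' d' n'"
    and x: "x \<in> cocycles C d n"
  shows "coh_map C' d' n' f (coh_class C d n x) = coh_class C' d' n' (f x)"
proof -
  interpret C: cochain_complex C d by fact
  interpret C': cochain_complex C' d' by fact
  have "coh_class C' d' n' (f y) = coh_class C' d' n' (f x)" if "y \<in> coh_class C d n x" for y
    using C'.class_eqI[OF assms(3)[OF C.mem_classD(1)[OF that]]] by simp
  moreover have "coh_class C d n x \<noteq> {}" using C.in_own_class[OF x] by blast
  ultimately show ?thesis unfolding coh_map_def by (intro SUP_eq_const)
qed

lemma coh_map2_class: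
  assumes "cochain_complex C d" "cochain_complex C' d'" "cochain_complex C'' d''"
    and f: "\<And>x' y'. (x, x') \<in> cohomologous C d n \<Longrightarrow> (y, y') \<in> cohomologous C' d' n'
      \<Longrightarrow> (f x y, f x' y') \<in> cohomologous C'' d'' n''"
    and x: "x \<in> cocycles C d n" and y: "y \<in> cocycles C' d' n'"
  shows "(\<Union>x'\<in>coh_class C d n x. \<Union>y'\<in>coh_class C' d' n' y. coh_class C'' d'' n'' (f x' y'))
    = coh_class C'' d'' n'' (f x y)"
proof -
  interpret C: cochain_complex C d by fact
  interpret C': cochain_complex C' d' by fact
  interpret C'': cochain_complex C'' d'' by fact
  have "coh_class C'' d'' n'' (f x' y') = coh_class C'' d'' n'' (f x y)"
    if "x' \<in> coh_class C d n x" "y' \<in> coh_class C' d' n' y" for x' y'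
    using C''.class_eqI[OF f[OF C.mem_classD(1) C'.mem_classD(1), OF that]] by simp
  moreover have "coh_class C d n x \<noteq> {}" "coh_class C' d' n' y \<noteq> {}"
    using C.in_own_class[OF x] C'.in_own_class[OF y] by blast+
  ultimately show ?thesis by (intro SUP_eq_const)
qed

text \<open>Letting \<open>f\<close> depend on the degree covers maps with signs such as
  \<open>Psi\<close> and \<open>palladio_map\<close>. The image of a primitive of
  \<open>x - y\<close> is the required primitive.\<close>

lemma chain_map_cohomologous:
  assumes C: "cochain_complex C d" and C': "cochain_complex C' d'"
    and closed: "\<And>k x. x \<in> C k \<Longrightarrow> f k x \<in> C' k"
    and diff: "\<And>k x y. x \<in> C k \<Longrightarrow> y \<in> C k \<Longrightarrow> f k (x - y) = f k x - f k y"
    and chain: "\<And>k x. x \<in> C k \<Longrightarrow> d' k (f k x) = f (k + 1) (d k x)"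
    and xy: "(x, y) \<in> cohomologous C d n"
  shows "(f n x, f n y) \<in> cohomologous C' d' n"
proof -
  interpret C: cochain_complex C d by fact
  interpret C': cochain_complex C' d' by fact
  from xy obtain v where v: "v \<in> C (n - 1)" "x - y = d (n - 1) v"
    and x: "x \<in> C n" and y: "y \<in> C n" "d n y = 0"
    by (auto simp: cohomologous_def cocycles_def coboundaries_def)
  have "f (n + 1) 0 = 0"
    using diff[OF C.zero_closed C.zero_closed, of "n + 1"] by simp
  then have "f n y \<in> cocycles C' d' n"
    using y closed chain by (simp add: cocycles_def)
  moreover have "f n x - f n y = d' (n - 1) (f (n - 1) v)"
    using diff[OF x y(1)] v chain[OF v(1)] by simp
  ultimately show ?thesis
    using C'.cohomologousI C'.coboundary[OF closed[OF v(1)]] by simp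
qed

section \<open>Homogeneous components, signs and multiplication by u on series\<close>

context graded_space
begin

lemma component_zero: "0 \<in> V i"
    and component_add: "x \<in> V i \<Longrightarrow> y \<in> V i \<Longrightarrow> x + y \<in> V i"
    and component_diff: "x \<in> V i \<Longrightarrow> y \<in> V i \<Longrightarrow> x - y \<in> V i"
  using subspace_component[of i] by (auto intro: subspace_0 subspace_add subspace_diff)

end

lemma linear_additive:
  assumes "Vector_Spaces.linear s t f"
  shows "f (x + y) = f x + f y" "f (x - y) = f x - f y" "f 0 = 0" "f (- x) = - f x"
  using assms
  by (auto simp: Vector_Spaces.linear_iff_module_hom module_hom.add module_hom.diff
      module_hom.zero module_hom.neg)

lemma ksgn_add: "ksgn k (x + y) = ksgn k x + ksgn k y"
  and ksgn_diff: "ksgn k (x - y) = ksgn k x - ksgn k y"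
  and ksgn_zero [simp]: "ksgn k 0 = 0"
  by (auto simp: ksgn_def)

lemma CC_memD:
  assumes "x \<in> CC M k"
  shows "x j \<in> M (k - 2 * j)" "j < 0 \<Longrightarrow> x j = 0" "x \<in> CC_per M k"
  using assms by (auto simp: CC_def CC_per_def)

lemma umult_add: "umult (x + y) = umult x + umult y"
  and umult_diff: "umult (x - y) = umult x - umult y"
  and umult_neg: "umult (- x) = - umult x"
  and umult_zero [simp]: "umult 0 = 0"
  and umult_ksgn: "umult (ksgn k x) = ksgn k (umult x)"
  for x y :: "int \<Rightarrow> 'a::ab_group_add"
  by (auto simp: umult_def fun_eq_iff ksgn_def)

text \<open>Series are indexed by all integers, so u is invertible on them and identities may be
  proved after multiplication by u.\<close>

lemma umult_inject: "umult x = umult y \<longleftrightarrow> x = y"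
proof
  assume "umult x = umult y"
  then have "umult x (j + 1) = umult y (j + 1)" for j by simp
  then show "x = y" by (simp add: umult_def fun_eq_iff)
qed simp

lemma umult_eq_0_iff: "umult x = 0 \<longleftrightarrow> x = 0" for x :: "int \<Rightarrow> 'a::ab_group_add"
  using umult_inject[of x 0] by simp

text \<open>Exactness of Connes' short exact sequence at its middle term.\<close>

lemma umult_exists:
  assumes "x \<in> CC M n" "x 0 = 0"
  obtains y where "y \<in> CC M (n - 2)" "x = umult y"
proof
  define y where "y = (\<lambda>j. x (j + 1))"
  show "x = umult y" by (simp add: y_def umult_def)
  have "y j \<in> M (n - 2 - 2 * j)" for j
    using CC_memD(1)[OF assms(1), of "j + 1"] by (simp add: y_def algebra_simps)
  moreover have "y j = 0" if "j < 0" for j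
  \<comment> \<open>At index -1 the shifted series reads \<open>x 0\<close>; only here does the
    vanishing at u = 0 enter.\<close>
  proof (cases "j = - 1")
    case True
    then show ?thesis using assms(2) by (simp add: y_def)
  next
    case False
    then show ?thesis using that CC_memD(2)[OF assms(1)] by (simp add: y_def)
  qed
  ultimately show "y \<in> CC M (n - 2)" by (simp add: CC_def CC_per_def)
qed

lemma umult_closed: "x \<in> CC M (n - 2) \<Longrightarrow> umult x \<in> CC M n"
proof -
  assume x: "x \<in> CC M (n - 2)"
  have "umult x j \<in> M (n - 2 * j)" for j
    using CC_memD(1)[OF x, of "j - 1"] by (simp add: umult_def algebra_simps)
  then show ?thesis using CC_memD(2)[OF x] by (simp add: CC_def CC_per_def umult_def)
qed

lemma uext_linear:
  assumes "Vector_Spaces.linear s t P"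
  shows "uext P (x + y) = uext P x + uext P y" "uext P (x - y) = uext P x - uext P y"
    "uext P 0 = 0" "uext P (- x) = - uext P x" "uext P (ksgn k x) = ksgn k (uext P x)"
    "uext P (umult x) = umult (uext P x)"
  by (auto simp: uext_def umult_def fun_eq_iff linear_additive[OF assms] ksgn_def)

section \<open>The cyclic complex and Connes' maps\<close>

context mixed_complex
begin

sublocale Mb: cochain_complex M "\<lambda>_. b"
  by unfold_locales
    (auto simp: component_zero component_diff b_degree b_b linear_additive[OF b_linear])

lemmas D_linear_simps = du_def uext_linear[OF b_linear] uext_linear[OF B_linear] umult_add
  umult_diff umult_neg umult_ksgn

lemma D_add: "du b B (x + y) = du b B x + du b B y"
  and D_diff: "du b B (x - y) = du b B x - du b B y"
  and D_neg: "du b B (- x) = - du b B x"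
  and D_ksgn: "du b B (ksgn k x) = ksgn k (du b B x)"
  and D_umult: "du b B (umult x) = umult (du b B x)"
  by (auto simp: D_linear_simps ksgn_add)

lemma D_per_closed: "x \<in> CC_per M n \<Longrightarrow> du b B x \<in> CC_per M (n + 1)"
proof -
  assume x: "x \<in> CC_per M n"
  have "du b B x j \<in> M (n + 1 - 2 * j)" for j
  proof -
    have "x j \<in> M (n - 2 * j)" "x (j - 1) \<in> M (n - 2 * (j - 1))"
      using x unfolding CC_per_def by blast+
    then have "b (x j) \<in> M (n + 1 - 2 * j)" "B (x (j - 1)) \<in> M (n + 1 - 2 * j)"
      using b_degree[of "x j" "n - 2 * j"] B_degree[of "x (j - 1)" "n - 2 * (j - 1)"]
      by (simp_all add: algebra_simps)
    then show ?thesis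
      by (simp add: du_def uext_def umult_def component_add)
  qed
  then show ?thesis by (simp add: CC_per_def)
qed

lemma D_D: "x \<in> CC_per M n \<Longrightarrow> du b B (du b B x) = 0"
proof
  fix j assume x: "x \<in> CC_per M n"
  \<comment> \<open>The coefficients of u^0, u^2 and u^1 in (b + uB)^2 vanish separately.\<close>
  have "b (b (x j)) = 0" "B (B (x (j - 1 - 1))) = 0" "b (B (x (j - 1))) + B (b (x (j - 1))) = 0"
    using x by (auto simp: CC_per_def intro: b_b B_B b_B)
  then show "du b B (du b B x) j = 0 j"
    by (simp add: du_def uext_def umult_def linear_additive[OF b_linear]
        linear_additive[OF B_linear])
qed

sublocale CCu: cochain_complex "CC M" "\<lambda>_. du b B"
proof
  show "x - y \<in> CC M n" if "x \<in> CC M n" "y \<in> CC M n" for x y n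
    using that by (auto simp: CC_def CC_per_def component_diff)
  show "du b B x \<in> CC M (n + 1)" if "x \<in> CC M n" for x n
  proof -
    have "du b B x j = 0" if "j < 0" for j
      using CC_memD(2)[OF \<open>x \<in> CC M n\<close>] that
      by (simp add: du_def uext_def umult_def linear_additive[OF b_linear]
        linear_additive[OF B_linear])
    then show ?thesis
      using D_per_closed[OF CC_memD(3)[OF that]] by (simp add: CC_def)
  qed
qed (auto simp: D_diff intro: D_D CC_memD(3) component_zero simp: CC_def CC_per_def)

lemma const_series_closed: "x \<in> M n \<Longrightarrow> const_series x \<in> CC M n"
  by (auto simp: const_series_def CC_def CC_per_def component_zero)

lemma ev0_cohomologous:
  assumes "(x, y) \<in> cohomologous (CC M) (\<lambda>_. du b B) n"
  shows "(ev0 x, ev0 y) \<in> cohomologous M (\<lambda>_. b) n"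
proof (rule chain_map_cohomologous[OF CCu.cochain_complex_axioms Mb.cochain_complex_axioms _ _ _ assms])
  show "ev0 x \<in> M k" if "x \<in> CC M k" for k x
    using CC_memD(1)[OF that, of 0] by (simp add: ev0_def)
  show "b (ev0 x) = ev0 (du b B x)" if "x \<in> CC M k" for k x
    \<comment> \<open>The constant term of \<open>du b B x\<close> also contains
      \<open>B (x (- 1))\<close>, which is zero on \<open>CC\<close>.\<close>
    using CC_memD(2)[OF that, of "- 1"]
    by (simp add: ev0_def du_def uext_def umult_def linear_additive[OF B_linear])
qed (simp add: ev0_def)

lemma connes_pi_class:
  assumes "x \<in> cocycles (CC M) (\<lambda>_. du b B) n"
  shows "connes_pi M b n (coh_class (CC M) (\<lambda>_. du b B) n x) = coh_class M (\<lambda>_. b) n (ev0 x)"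
  unfolding connes_pi_def
  using coh_map_class[OF CCu.cochain_complex_axioms Mb.cochain_complex_axioms ev0_cohomologous assms] .

lemma HC_sign_class:
  assumes "x \<in> cocycles (CC M) (\<lambda>_. du b B) n"
  shows "HC_sign M b B n k (coh_class (CC M) (\<lambda>_. du b B) n x)
    = coh_class (CC M) (\<lambda>_. du b B) n (ksgn k x)"
  unfolding HC_sign_def
  by (rule coh_map_class[OF CCu.cochain_complex_axioms CCu.cochain_complex_axioms
        CCu.cohomologous_ksgn assms])

text \<open>The representative \<open>const_series (B x)\<close> carries the sign through the
  connecting map, so that the sign in front of it can be matched with one found on cocycles of
  \<open>M\<close>.\<close>

lemma HC_sign_connes_beta:
  assumes x: "x \<in> cocycles M (\<lambda>_. b) (n + 1)"
  shows "HC_sign M b B n k (connes_beta M b B (n + 1) (coh_class M (\<lambda>_. b) (n + 1) x))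
    = connes_beta M b B (n + 1) (coh_class M (\<lambda>_. b) (n + 1) (ksgn k x))"
proof -
  have "ksgn k x \<in> cocycles M (\<lambda>_. b) (n + 1)"
    using x by (simp add: ksgn_def Mb.cocycle_neg)
  moreover have "ksgn k (const_series (B x)) = const_series (B (ksgn k x))"
    by (auto simp: ksgn_def const_series_def fun_eq_iff linear_additive[OF B_linear])
  ultimately show ?thesis
    using HC_sign_class const_series_cocycle[OF x] by (simp add: connes_beta_class x)
qed

text \<open>Any lift along \<open>ev0\<close> may be used, not only a constant series. Membership of
  \<open>y\<close> in \<open>CC\<close> is a genuine condition, since dividing a series in
  \<open>CC\<close> by u can leave a coefficient at -1.\<close>

lemma connes_beta_eqI:
  assumes x: "x \<in> CC M n" "ev0 x \<in> coh_class M (\<lambda>_. b) n c" and y: "du b B x = umult y"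
    "y \<in> CC M (n - 1)"
  shows "connes_beta M b B n (coh_class M (\<lambda>_. b) n c) = coh_class (CC M) (\<lambda>_. du b B) (n - 1) y"
proof -
  \<comment> \<open>The differential commutes with u, so u times the differential of
    \<open>y\<close> is the square of the differential at \<open>x\<close>; then u is
    cancelled.\<close>
  have "du b B y = 0"
    using CCu.d_d[OF x(1)] y(1) by (simp add: D_umult umult_eq_0_iff)
  then have "y \<in> connes_beta M b B n (coh_class M (\<lambda>_. b) n c)"
    using assms by (auto simp: connes_beta_def cocycles_def)
  moreover have c: "c \<in> cocycles M (\<lambda>_. b) n" by (rule Mb.mem_classD(2)[OF x(2)])
  ultimately show ?thesis
    using CCu.mem_classD(4) unfolding connes_beta_class[OF c] by metis
qed

end


section \<open>The Cartan identities on series\<close>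

context homotopy_pre_cartan_calculus
begin

sublocale g: cochain_complex G "\<lambda>_. \<delta>"
  by unfold_locales
    (auto simp: g.component_zero g.component_diff g.\<delta>_degree g.\<delta>_\<delta> linear_additive[OF g.\<delta>_linear])

abbreviation "D \<equiv> du b B"
abbreviation "I \<equiv> cartan_I \<iota> S"

lemmas ext_linear_simps = linear_additive[OF \<iota>_linear_left] linear_additive[OF \<iota>_linear_right]
  linear_additive[OF L_linear_left] linear_additive[OF L_linear_right]
  linear_additive[OF S_linear_left] linear_additive[OF S_linear_right]
  linear_additive[OF M.b_linear] linear_additive[OF M.B_linear]

lemma I_neg: "I f (- x) = - I f x"
  and I_zero: "I f 0 = 0"
  and I_diff_left: "I (f - g) x = I f x - I g x"
  and I_neg_left: "I (- f) x = - I f x"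
  and I_zero_left: "I 0 x = 0"
  by (auto simp: cartan_I_def uext_def umult_def fun_eq_iff ext_linear_simps)

lemma L_diff: "uext (L f) (x - y) = uext (L f) x - uext (L f) y"
  and L_add: "uext (L f) (x + y) = uext (L f) x + uext (L f) y"
  and L_neg: "uext (L f) (- x) = - uext (L f) x"
  and L_zero: "uext (L f) 0 = 0"
  and L_umult: "uext (L f) (umult x) = umult (uext (L f) x)"
  and L_diff_left: "uext (L (f - g)) x = uext (L f) x - uext (L g) x"
  and L_zero_left: "uext (L 0) x = 0"
  by (auto simp: uext_def umult_def fun_eq_iff ext_linear_simps)

lemma I_closed:
  assumes f: "f \<in> G i" and x: "x \<in> CC M n"
  shows "I f x \<in> CC M (i + n + 1)"
proof -
  have "I f x j \<in> M (i + n + 1 - 2 * j)" for j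
  proof -
    \<comment> \<open>\<open>S f\<close> lowers degrees by one but comes with u, of degree 2, so
      both summands land in the same component.\<close>
    have "\<iota> f (x j) \<in> M (i + n + 1 - 2 * j)" "S f (x (j - 1)) \<in> M (i + n + 1 - 2 * j)"
      using \<iota>_degree[OF f CC_memD(1)[OF x, of j]] S_degree[OF f CC_memD(1)[OF x, of "j - 1"]]
      by (simp_all add: shift_def algebra_simps)
    then show ?thesis
      by (simp add: cartan_I_def uext_def umult_def M.component_add)
  qed
  then show ?thesis
    using CC_memD(2)[OF x]
    by (simp add: CC_def CC_per_def cartan_I_def uext_def umult_def ext_linear_simps)
qed

lemma L_closed:
  assumes f: "f \<in> G i" and x: "x \<in> CC M n"
  shows "uext (L f) x \<in> CC M (i + n)"
proof -
  have "uext (L f) x j \<in> M (i + n - 2 * j)" for j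
    using L_degree[OF f CC_memD(1)[OF x, of j]] by (simp add: uext_def algebra_simps)
  then show ?thesis
    using CC_memD(2)[OF x] by (simp add: CC_def CC_per_def uext_def ext_linear_simps)
qed

text \<open>The three pre-Cartan axioms \<open>b_\<iota>\<close>, \<open>L_eq\<close> and
  \<open>B_S\<close> are the coefficients of u^0, u^1 and u^2 in the single identity [d_u, I_f] = u
  L_f - I_{\<delta> f}.\<close>

lemma D_I:
  assumes f: "f \<in> G i" and x: "x \<in> CC M n"
  shows "D (I f x) = ksgn (i + 1) (I f (D x)) + umult (uext (L f) x) - I (\<delta> f) x"
proof
  fix j
  note xM = CC_memD(1)[OF x]
  \<comment> \<open>All the commutator signs have the parity of \<open>i + 1\<close>, so the axioms
    are rewritten with \<open>ksgn (i + 1)\<close> throughout.\<close>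
  have "b (\<iota> f (x j)) = ksgn (i + 1) (\<iota> f (b (x j))) - \<iota> (\<delta> f) (x j)"
    using b_\<iota>[OF f xM, of j] by (simp add: gcomm_def algebra_simps eq_diff_eq)
  moreover have "L f (x (j - 1)) = B (\<iota> f (x (j - 1))) - ksgn (i + 1) (\<iota> f (B (x (j - 1))))
      + b (S f (x (j - 1))) - ksgn (i + 1) (S f (b (x (j - 1)))) + S (\<delta> f) (x (j - 1))"
    using L_eq[OF f xM, of "j - 1"] by (simp add: gcomm_def ksgn_def)
  moreover have "B (S f (x (j - 1 - 1))) = ksgn (i + 1) (S f (B (x (j - 1 - 1))))"
    using B_S[OF f xM, of "j - 1 - 1"] by (simp add: gcomm_def ksgn_def split: if_splits)
  moreover have "ksgn k y j = ksgn k (y j)" for k and y :: "int \<Rightarrow> 'm"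
    by (simp add: ksgn_def)
  ultimately show "D (I f x) j = (ksgn (i + 1) (I f (D x)) + umult (uext (L f) x) - I (\<delta> f) x) j"
    by (simp add: du_def cartan_I_def uext_def umult_def ext_linear_simps ksgn_add)
qed

text \<open>Obtained by applying \<open>D\<close> to \<open>D_I\<close> and cancelling \<open>u\<close>.\<close>

lemma D_L:
  assumes f: "f \<in> G i" and x: "x \<in> CC M n"
  shows "D (uext (L f) x) = ksgn i (uext (L f) (D x)) + uext (L (\<delta> f)) x"
proof -
  note Dx = M.CCu.d_closed[OF x] and \<delta>f = g.\<delta>_degree[OF f]
  have "umult (uext (L f) x) = D (I f x) - ksgn (i + 1) (I f (D x)) + I (\<delta> f) x"
    using D_I[OF f x] by (simp add: algebra_simps)
  then have "umult (D (uext (L f) x)) = - ksgn (i + 1) (D (I f (D x))) + D (I (\<delta> f) x)"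
    using M.CCu.d_d[OF I_closed[OF f x]]
    by (simp add: M.D_umult[symmetric] M.D_diff M.D_add M.D_ksgn)
  \<comment> \<open>The two terms in \<open>I (\<delta> f) (D x)\<close> cancel, which leaves only
    multiples of u.\<close>
  also have "\<dots> = umult (ksgn i (uext (L f) (D x)) + uext (L (\<delta> f)) x)"
    using M.CCu.d_d[OF x] g.\<delta>_\<delta>[OF f]
    by (cases "even i")
      (simp_all add: D_I[OF f Dx] D_I[OF \<delta>f x] I_zero I_zero_left umult_add umult_neg umult_diff ksgn_def)
  finally show ?thesis by (simp add: umult_inject)
qed

end

section \<open>The twisted semidirect product, its map to the cyclic complex, and the
  bracket\<close>

locale twisted_cartan_calculus =
  homotopy_cartan_calculus scaleM M b B scaleG G \<delta> br \<iota> L S T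
  for scaleM :: "'k::field \<Rightarrow> 'm::ab_group_add \<Rightarrow> 'm" and M b B
    and scaleG :: "'k \<Rightarrow> 'g::ab_group_add \<Rightarrow> 'g" and G \<delta> br \<iota> L S T +
  fixes \<zeta>h :: "int \<Rightarrow> 'm"
  assumes \<zeta>h: "\<zeta>h \<in> cocycles (CC M) (\<lambda>_. du b B) (- 1)"
begin

abbreviation "d\<^sub>\<zeta> \<equiv> semidirect_diff b B \<delta> L \<zeta>h"
abbreviation "\<Psi> \<equiv> Psi \<iota> S \<zeta>h"

lemma \<zeta>hD: "\<zeta>h \<in> CC M (- 1)" "D \<zeta>h = 0"
  using \<zeta>h by (auto simp: cocycles_def)

lemma mem_semidirect: "(f, x) \<in> semidirect M G n \<longleftrightarrow> f \<in> G n \<and> x \<in> CC M (n - 2)"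
  by (simp add: semidirect_def shift_def)

sublocale semidirect: cochain_complex "semidirect M G" d\<^sub>\<zeta>
proof
  show "0 \<in> semidirect M G n" for n
    by (simp add: zero_prod_def mem_semidirect M.CCu.zero_closed g.zero_closed)
  fix p q n assume p: "p \<in> semidirect M G n"
  obtain f x where pe: "p = (f, x)" by (cases p)
  with p have f: "f \<in> G n" and x: "x \<in> CC M (n - 2)" by (auto simp: mem_semidirect)
  have "du b B x \<in> CC M (n + 1 - 2)" "uext (L f) \<zeta>h \<in> CC M (n + 1 - 2)"
    using M.CCu.d_closed[OF x] L_closed[OF f \<zeta>hD(1)] by (simp_all add: algebra_simps)
  then show "d\<^sub>\<zeta> n p \<in> semidirect M G (n + 1)"
    by (simp add: pe mem_semidirect semidirect_diff_def g.d_closed[OF f] M.CCu.add_closed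
        M.CCu.ksgn_closed)
  have "D (uext (L f) \<zeta>h) = uext (L (\<delta> f)) \<zeta>h"
    by (simp add: D_L[OF f \<zeta>hD(1)] \<zeta>hD(2) L_zero)
  \<comment> \<open>The twist appears twice, once differentiated and once through
    \<open>\<delta> f\<close>, with signs from consecutive degrees, so it cancels.\<close>
  then have "D (D x + ksgn n (uext (L f) \<zeta>h)) + ksgn (n + 1) (uext (L (\<delta> f)) \<zeta>h) = 0"
    using M.CCu.d_d[OF x] by (simp add: M.D_add M.D_ksgn) (simp add: ksgn_def)
  then show "d\<^sub>\<zeta> (n + 1) (d\<^sub>\<zeta> n p) = 0"
    using g.d_d[OF f] by (simp add: pe semidirect_diff_def zero_prod_def)
  assume q: "q \<in> semidirect M G n"
  show "p - q \<in> semidirect M G n"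
    using p q by (cases p, cases q) (auto simp: mem_semidirect g.diff_closed M.CCu.diff_closed)
  show "d\<^sub>\<zeta> n (p - q) = d\<^sub>\<zeta> n p - d\<^sub>\<zeta> n q"
    by (cases p, cases q)
      (simp add: semidirect_diff_def linear_additive[OF g.\<delta>_linear] M.D_diff L_diff_left ksgn_diff)
qed

lemma Psi_closed:
  assumes "p \<in> semidirect M G n"
  shows "\<Psi> n p \<in> CC M n"
proof -
  obtain f x where p: "p = (f, x)" by (cases p)
  then have f: "f \<in> G n" and x: "x \<in> CC M (n - 2)" using assms by (auto simp: mem_semidirect)
  show ?thesis
    using I_closed[OF f \<zeta>hD(1)] umult_closed[OF x]
    by (simp add: p Psi_def M.CCu.add_closed M.CCu.ksgn_closed)
qed

lemma Psi_diff: "\<Psi> n (p - q) = \<Psi> n p - \<Psi> n q"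
  by (cases p, cases q) (simp add: Psi_def I_diff_left umult_diff ksgn_diff)

text \<open>Since \<open>\<zeta>h\<close> is closed, \<open>D_I\<close> turns
  \<open>D (I f \<zeta>h)\<close> into u L_f \<open>\<zeta>h\<close> - I_{\<delta> f}
  \<open>\<zeta>h\<close>. The first term is u times the twist of the differential; the minus sign
  of the second is the change from \<open>ksgn n\<close> to \<open>ksgn (n + 1)\<close>.\<close>

lemma Psi_chain:
  assumes "p \<in> semidirect M G n"
  shows "D (\<Psi> n p) = \<Psi> (n + 1) (d\<^sub>\<zeta> n p)"
proof -
  obtain f x where p: "p = (f, x)" by (cases p)
  then have f: "f \<in> G n" and x: "x \<in> CC M (n - 2)" using assms by (auto simp: mem_semidirect)
  show ?thesis
    by (cases "even n")
      (simp_all add: p Psi_def semidirect_diff_def M.D_add M.D_diff M.D_neg M.D_umult D_I[OF f \<zeta>hD(1)] \<zeta>hD(2)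
        I_zero ksgn_def umult_add umult_neg umult_diff algebra_simps)
qed

lemma Psi_cohomologous:
  assumes "(p, q) \<in> cohomologous (semidirect M G) d\<^sub>\<zeta> n"
  shows "(\<Psi> n p, \<Psi> n q) \<in> cohomologous (CC M) (\<lambda>_. D) n"
  by (rule chain_map_cohomologous[OF semidirect.cochain_complex_axioms M.CCu.cochain_complex_axioms
        Psi_closed Psi_diff Psi_chain assms])

lemma Psi_iso_class:
  assumes "p \<in> cocycles (semidirect M G) d\<^sub>\<zeta> n"
  shows "Psi_iso M b B \<iota> S \<zeta>h n (coh_class (semidirect M G) d\<^sub>\<zeta> n p) = coh_class (CC M) (\<lambda>_. D) n (\<Psi> n p)"
  unfolding Psi_iso_def
  by (rule coh_map_class[OF semidirect.cochain_complex_axioms M.CCu.cochain_complex_axioms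
        Psi_cohomologous assms])

lemma Psi_cocycle:
  assumes "p \<in> cocycles (semidirect M G) d\<^sub>\<zeta> n"
  shows "\<Psi> n p \<in> cocycles (CC M) (\<lambda>_. D) n"
  by (rule M.CCu.cohomologous_cocycle(1)[OF Psi_cohomologous[OF semidirect.cohomologous_refl[OF assms]]])

text \<open>At u = 0 only the Lie component survives. This is the link between \<open>Psi\<close>
  and duality, with \<open>ev0 \<zeta>h\<close> in place of \<open>\<zeta>\<close>.\<close>

lemma ev0_Psi: "p \<in> semidirect M G n \<Longrightarrow> ev0 (\<Psi> n p) = palladio_map \<iota> (ev0 \<zeta>h) n (fst p)"
  using CC_memD(2)[OF \<zeta>hD(1), of "- 1"] CC_memD(2)[of "snd p" M "n - 2" "- 1"]
  by (cases p) (auto simp: mem_semidirect Psi_def palladio_map_def ev0_def cartan_I_def uext_def umult_def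
      ksgn_def ext_linear_simps)

text \<open>After antisymmetry, \<open>cartan_homotopy\<close> for \<open>g\<close>,
  \<open>f\<close> trades I_{g,f} \<open>\<zeta>h\<close> for L_f I_g \<open>\<zeta>h\<close>, a
  summand of L_f applied to the image of \<open>(g, y)\<close>, and for I_g L_f
  \<open>\<zeta>h\<close>. The cocycle condition on \<open>(f, x)\<close> makes the latter a sign
  times \<open>I g (D x)\<close>, and \<open>D_I\<close> replaces this by the exact term
  \<open>D (I g x)\<close> and u L_g \<open>x\<close>, which cancels against the bracket.\<close>

lemma Psi_bracket:
  assumes p: "(f, x) \<in> cocycles (semidirect M G) d\<^sub>\<zeta> m" and q: "(g, y) \<in> cocycles (semidirect M G) d\<^sub>\<zeta> n"
  shows "\<Psi> (m + n) (semidirect_bracket br L m n (f, x) (g, y)) =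
    uext (L f) (\<Psi> n (g, y))
      - ksgn (m * n) (D (I g x - ksgn (m + n) (uext (T g f) \<zeta>h)))"
proof -
  have f: "f \<in> G m" "\<delta> f = 0" and x: "x \<in> CC M (m - 2)" and Dx: "D x = - ksgn m (uext (L f) \<zeta>h)"
    and g: "g \<in> G n" "\<delta> g = 0"
    using p q by (auto simp: cocycles_def mem_semidirect semidirect_diff_def zero_prod_def
        eq_neg_iff_add_eq_0)
  \<comment> \<open>With \<open>f\<close>, \<open>g\<close> and \<open>\<zeta>h\<close> closed,
    these vanishings reduce the right side of \<open>cartan_homotopy\<close> to one exact
    term.\<close>
  have T0: "uext (T g 0) \<zeta>h = 0" "uext (T 0 f) \<zeta>h = 0" "uext (T g f) 0 = 0"
    by (auto simp: uext_def fun_eq_iff linear_additive[OF T_linear1] linear_additive[OF T_linear2]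
        linear_additive[OF T_linear3])
  have Lf: "uext (L f) \<zeta>h = - ksgn m (D x)"
    using Dx by (simp add: ksgn_def)
  have DIx: "D (I g x) = ksgn (n + 1) (I g (D x)) + umult (uext (L g) x)"
    using D_I[OF g(1) x] g(2) by (simp add: I_zero_left)
  have DT: "D (uext (T g f) \<zeta>h) =
      I g (uext (L f) \<zeta>h) - ksgn ((n + 1) * m) (uext (L f) (I g \<zeta>h)) - I (br g f) \<zeta>h"
    using cartan_homotopy[OF g(1) f(1) CC_memD(3)[OF \<zeta>hD(1)]] f g \<zeta>hD(2) T0
    by (simp add: gcomm_def)
  show ?thesis
    by (cases "even m"; cases "even n")
      (simp_all add: Psi_def semidirect_bracket_def M.D_diff M.D_add M.D_neg g.br_antisym[OF f(1) g(1)]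
         DIx DT Lf I_neg I_neg_left L_add L_diff L_neg L_umult umult_add umult_diff umult_neg ksgn_def algebra_simps)
qed

text \<open>Ensures that the exact correction in \<open>Psi_bracket\<close> is a coboundary within
  \<open>CC\<close>: its primitive has the right degree and no negative powers of u.\<close>

lemma bracket_homotopy_closed:
  assumes f: "f \<in> G m" and x: "x \<in> CC M (m - 2)" and g: "g \<in> G n"
  shows "I g x - ksgn (m + n) (uext (T g f) \<zeta>h) \<in> CC M (m + n - 1)"
proof -
  have "I g x \<in> CC M (m + n - 1)"
    using I_closed[OF g x] by (simp add: algebra_simps)
  moreover have "uext (T g f) \<zeta>h j \<in> M (m + n - 1 - 2 * j)" for j
    using T_degree[OF g f CC_memD(1)[OF \<zeta>hD(1), of j]] by (simp add: uext_def algebra_simps)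
  then have "uext (T g f) \<zeta>h \<in> CC M (m + n - 1)"
    using CC_memD(2)[OF \<zeta>hD(1)]
    by (simp add: CC_def CC_per_def uext_def linear_additive[OF T_linear3])
  ultimately show ?thesis
    by (simp add: M.CCu.diff_closed M.CCu.ksgn_closed)
qed

text \<open>
  The \<open>G\<close>-component of the differential of the bracket vanishes, and \<open>\<Psi>\<close> is injective on the other
  one, so it suffices that \<open>\<Psi>\<close> of the bracket is a cocycle.
\<close>

lemma bracket_cocycle:
  assumes p: "p \<in> cocycles (semidirect M G) d\<^sub>\<zeta> m" and q: "q \<in> cocycles (semidirect M G) d\<^sub>\<zeta> n"
  shows "semidirect_bracket br L m n p q \<in> cocycles (semidirect M G) d\<^sub>\<zeta> (m + n)" (is "?r \<in> _")
proof -
  obtain f x g y where pq: "p = (f, x)" "q = (g, y)" by (cases p, cases q)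
  have f: "f \<in> G m" "\<delta> f = 0" and x: "x \<in> CC M (m - 2)"
    and g: "g \<in> G n" "\<delta> g = 0" and y: "y \<in> CC M (n - 2)"
    using p q by (auto simp: pq cocycles_def mem_semidirect semidirect_diff_def zero_prod_def)
  have "uext (L f) y \<in> CC M (m + n - 2)" "uext (L g) x \<in> CC M (m + n - 2)"
    using L_closed[OF f(1) y] L_closed[OF g(1) x] by (simp_all add: algebra_simps)
  then have r: "?r \<in> semidirect M G (m + n)"
    by (simp add: pq semidirect_bracket_def mem_semidirect g.br_degree[OF f(1) g(1)]
        M.CCu.diff_closed M.CCu.ksgn_closed)
  have "\<delta> (br f g) = 0"
    using g.\<delta>_br[OF f(1) g(1)] f g linear_additive(3)[OF g.br_linear_left]
      linear_additive(3)[OF g.br_linear_right] by simp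
  then obtain s where s: "d\<^sub>\<zeta> (m + n) ?r = (0, s)"
    by (simp add: pq semidirect_bracket_def semidirect_diff_def)
  have W: "\<Psi> n q \<in> CC M n" "D (\<Psi> n q) = 0"
    using Psi_cocycle[OF q] by (auto simp: cocycles_def)
  note v = bracket_homotopy_closed[OF f(1) x g(1)]
  have "D (uext (L f) (\<Psi> n q)) = 0"
    using D_L[OF f(1) W(1)] f(2) W(2) by (simp add: L_zero L_zero_left)
  then have "D (\<Psi> (m + n) ?r) = 0"
    using Psi_bracket[OF p[unfolded pq] q[unfolded pq]] M.CCu.d_d[OF v]
    by (simp add: pq M.D_diff M.D_ksgn del: fun_diff_def)
  then have "s = 0"
    using Psi_chain[OF r] by (simp add: s Psi_def I_zero_left umult_eq_0_iff)
  then show ?thesis using r s by (simp add: cocycles_def zero_prod_def)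
qed

end


section \<open>Palladio duality and the product on cohomology\<close>

locale palladio_calculus =
  homotopy_cartan_gerstenhaber_calculus scaleM M b B scaleG G \<delta> br \<iota> L S T cup e +
  twisted_cartan_calculus scaleM M b B scaleG G \<delta> br \<iota> L S T \<zeta>h
  for scaleM :: "'k::field \<Rightarrow> 'm::ab_group_add \<Rightarrow> 'm" and M b B
    and scaleG :: "'k \<Rightarrow> 'g::ab_group_add \<Rightarrow> 'g" and G \<delta> br \<iota> L S T cup e \<zeta>h +
  fixes \<zeta> :: 'm
  assumes palladio: "palladio_cocycle M b B G \<delta> \<iota> \<zeta>"
    and ev0_\<zeta>h: "(ev0 \<zeta>h, \<zeta>) \<in> cohomologous M (\<lambda>_. b) (- 1)"
begin

lemma cup_closed: "f \<in> G m \<Longrightarrow> g \<in> G n \<Longrightarrow> cup f g \<in> G (m + n + 1)"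
  using cup_degree[of f "m + 1" g "n + 1"] by (simp add: shift_def algebra_simps)

text \<open>In the sign \<open>f\<close> counts with its degree \<open>m + 1\<close> in
  \<open>shift G (- 1)\<close>.\<close>

lemma \<delta>_cup_G: "f \<in> G m \<Longrightarrow> g \<in> G n \<Longrightarrow> \<delta> (cup f g) = cup (\<delta> f) g + ksgn (m + 1) (cup f (\<delta> g))"
  using \<delta>_cup[of f "m + 1" g "n + 1"] by (simp add: shift_def)

lemmas cup_linear = linear_additive[OF cup_linear_left] linear_additive[OF cup_linear_right]

lemma cup_cocycle:
  assumes "f \<in> cocycles G (\<lambda>_. \<delta>) m" "g \<in> cocycles G (\<lambda>_. \<delta>) n"
  shows "cup f g \<in> cocycles G (\<lambda>_. \<delta>) (m + n + 1)"
proof -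
  have "f \<in> G m" "\<delta> f = 0" "g \<in> G n" "\<delta> g = 0"
    using assms by (auto simp: cocycles_def)
  then show ?thesis
    using \<delta>_cup_G[of f m g n] by (simp add: cocycles_def cup_closed cup_linear)
qed

lemma cup_cohomologous:
  assumes f: "(f, f') \<in> cohomologous G (\<lambda>_. \<delta>) m" and g: "(g, g') \<in> cohomologous G (\<lambda>_. \<delta>) n"
  shows "(cup f g, cup f' g') \<in> cohomologous G (\<lambda>_. \<delta>) (m + n + 1)"
proof -
  have f': "f \<in> G m" "\<delta> f = 0" "f' \<in> cocycles G (\<lambda>_. \<delta>) m"
    and g': "g' \<in> G n" "\<delta> g' = 0" "g' \<in> cocycles G (\<lambda>_. \<delta>) n"
    using f g by (auto simp: cohomologous_def cocycles_def)
  from f g obtain h k where h: "h \<in> G (m - 1)" "f - f' = \<delta> h" and k: "k \<in> G (n - 1)" "g - g' = \<delta> k"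
    by (auto simp: cohomologous_def coboundaries_def)
  \<comment> \<open>One factor is changed at a time; the closed elements \<open>g'\<close> and
    \<open>f\<close> make \<open>cup h g'\<close> and, up to sign, \<open>cup f k\<close> primitives
    of the two differences.\<close>
  have "cup f g - cup f' g' = cup (f - f') g' + cup f (g - g')"
    by (simp add: cup_linear)
  also have "\<dots> = \<delta> (cup h g') + ksgn (m + 1) (\<delta> (cup f k))"
    using \<delta>_cup_G[OF h(1) g'(1)] \<delta>_cup_G[OF f'(1) k(1)] f' g'
    by (simp add: h k cup_linear ksgn_def)
  also have "\<dots> \<in> coboundaries G (\<lambda>_. \<delta>) (m + n + 1)"
    using cup_closed[OF h(1) g'(1)] cup_closed[OF f'(1) k(1)]
    by (intro g.coboundary_add g.coboundary_ksgn g.coboundary) (simp_all add: algebra_simps)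
  finally show ?thesis
    using cup_cocycle[OF f'(3) g'(3)] by (intro g.cohomologousI)
qed

lemma palladio_map_qi: "quasi_isomorphism G (\<lambda>_. \<delta>) M (\<lambda>_. b) (palladio_map \<iota> \<zeta>)"
  using palladio by (simp add: palladio_cocycle_def)

lemma palladio_map_cohomologous:
  "(f, f') \<in> cohomologous G (\<lambda>_. \<delta>) n \<Longrightarrow>
    (palladio_map \<iota> \<zeta> n f, palladio_map \<iota> \<zeta> n f') \<in> cohomologous M (\<lambda>_. b) n"
  by (rule chain_map_cohomologous[OF g.cochain_complex_axioms M.Mb.cochain_complex_axioms])
    (use palladio_map_qi in \<open>auto simp: quasi_isomorphism_def palladio_map_def ext_linear_simps ksgn_diff\<close>)

lemma palladio_iso_class:
  assumes "f \<in> cocycles G (\<lambda>_. \<delta>) n"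
  shows "palladio_iso M b \<iota> \<zeta> n (coh_class G (\<lambda>_. \<delta>) n f) = coh_class M (\<lambda>_. b) n (palladio_map \<iota> \<zeta> n f)"
  unfolding palladio_iso_def
  by (rule coh_map_class[OF g.cochain_complex_axioms M.Mb.cochain_complex_axioms
        palladio_map_cohomologous assms])

text \<open>\<open>\<zeta>h\<close> lifts \<open>\<zeta>\<close> only up to a coboundary
  \<open>b k\<close>. For closed \<open>f\<close> the operators \<open>b\<close> and
  \<open>\<iota> f\<close> commute up to a sign, which \<open>ksgn n\<close> in
  \<open>palladio_map\<close> compensates, so \<open>- \<iota> f k\<close> is a primitive in every
  degree.\<close>

lemma palladio_map_ev0:
  assumes "f \<in> cocycles G (\<lambda>_. \<delta>) n"
  shows "(palladio_map \<iota> (ev0 \<zeta>h) n f, palladio_map \<iota> \<zeta> n f) \<in> cohomologous M (\<lambda>_. b) n"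
proof -
  have f: "f \<in> G n" "\<delta> f = 0" using assms by (auto simp: cocycles_def)
  obtain k where k: "k \<in> M (- 1 - 1)" "ev0 \<zeta>h - \<zeta> = b k"
    using ev0_\<zeta>h by (auto simp: cohomologous_def coboundaries_def)
  have "\<iota> f k \<in> M (n - 1)"
    using \<iota>_degree[OF f(1) k(1)] by (simp add: shift_def)
  moreover have "palladio_map \<iota> (ev0 \<zeta>h) n f - palladio_map \<iota> \<zeta> n f = - b (\<iota> f k)"
    using b_\<iota>[OF f(1) k(1)] f(2)
    by (simp add: palladio_map_def ksgn_diff[symmetric] linear_additive(2)[OF \<iota>_linear_right, symmetric]
        k(2) gcomm_def ext_linear_simps) (simp add: ksgn_def split: if_splits)
  moreover have "palladio_map \<iota> \<zeta> n f \<in> cocycles M (\<lambda>_. b) n"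
    by (rule M.Mb.cohomologous_cocycle(1)[OF palladio_map_cohomologous[OF g.cohomologous_refl[OF assms]]])
  ultimately show ?thesis
    using M.Mb.coboundary_neg[OF M.Mb.coboundary] by (intro M.Mb.cohomologousI) simp_all
qed

section \<open>Projection to the Lie algebra and surjectivity of \<open>Psi\<close> on
  cohomology\<close>

lemma fst_cocycle: "p \<in> cocycles (semidirect M G) d\<^sub>\<zeta> n \<Longrightarrow> fst p \<in> cocycles G (\<lambda>_. \<delta>) n"
  by (cases p) (auto simp: cocycles_def mem_semidirect semidirect_diff_def zero_prod_def)

text \<open>
  Surjectivity of \<open>\<Psi>\<close> on cohomology suffices: \<open>HC_bracket\<close> takes some preimage under \<open>\<Psi>\<close>, and
  the formula holds for every choice of preimages.
\<close>

lemma Psi_iso_surj: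
  assumes "z \<in> HC M b B n"
  shows "z \<in> Psi_iso M b B \<iota> S \<zeta>h n ` cohomology (semidirect M G) d\<^sub>\<zeta> n"
proof -
  from assms obtain x where x: "x \<in> cocycles (CC M) (\<lambda>_. D) n" and z: "z = coh_class (CC M) (\<lambda>_. D) n x"
    by (rule M.CCu.cohomology_cases)
  \<comment> \<open>Duality is applied to the value at u = 0 and gives a closed \<open>f\<close>
    whose dual is cohomologous to \<open>ev0 x\<close>.\<close>
  have "coh_class M (\<lambda>_. b) n (ev0 x) \<in> cohomology M (\<lambda>_. b) n"
    by (rule M.Mb.class_in_cohomology[OF M.Mb.cohomologous_cocycle(1)[OF
          M.ev0_cohomologous[OF M.CCu.cohomologous_refl[OF x]]]])
  also have "\<dots> = palladio_iso M b \<iota> \<zeta> n ` cohomology G (\<lambda>_. \<delta>) n"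
    using palladio_map_qi by (auto simp: quasi_isomorphism_def bij_betw_def palladio_iso_def)
  finally obtain f where f: "f \<in> cocycles G (\<lambda>_. \<delta>) n"
    and "coh_class M (\<lambda>_. b) n (ev0 x) = coh_class M (\<lambda>_. b) n (palladio_map \<iota> \<zeta> n f)"
    by (auto simp: palladio_iso_class elim!: g.cohomology_cases)
  then have "coh_class M (\<lambda>_. b) n (ev0 x) = coh_class M (\<lambda>_. b) n (palladio_map \<iota> (ev0 \<zeta>h) n f)"
    using M.Mb.class_eqI[OF palladio_map_ev0[OF f]] by simp
  then have "palladio_map \<iota> (ev0 \<zeta>h) n f \<in> coh_class M (\<lambda>_. b) n (ev0 x)"
    using palladio_map_ev0[OF f] M.Mb.in_own_class by (auto simp: cohomologous_def)
  then obtain k where k: "k \<in> M (n - 1)" "ev0 x - palladio_map \<iota> (ev0 \<zeta>h) n f = b k"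
    using M.Mb.mem_classD(1) by (fastforce simp: cohomologous_def coboundaries_def)
  \<comment> \<open>The differential of the constant series \<open>k\<close> has value
    \<open>b k\<close> at u = 0. Subtracting it removes the remaining discrepancy there, so the rest
    is divisible by u and supplies the second component \<open>y\<close>.\<close>
  define v where "v = const_series k"
  have v: "v \<in> CC M (n - 1)" unfolding v_def by (rule M.const_series_closed[OF k(1)])
  have xn: "x \<in> CC M n" "D x = 0" using x by (auto simp: cocycles_def)
  have fG: "f \<in> G n" "\<delta> f = 0" using f by (auto simp: cocycles_def)
  have f0: "(f, 0) \<in> semidirect M G n"
    using fG by (simp add: mem_semidirect M.CCu.zero_closed)
  define r where "r = x - \<Psi> n (f, 0) - D v"
  have "r \<in> CC M n"
    using xn Psi_closed[OF f0] M.CCu.d_closed[OF v] by (simp add: r_def M.CCu.diff_closed)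
  moreover have "r 0 = 0"
    using k(2) ev0_Psi[OF f0]
    by (simp add: r_def v_def ev0_def du_def uext_def umult_def const_series_def ext_linear_simps)
  ultimately obtain y where y: "y \<in> CC M (n - 2)" "r = umult y"
    by (rule umult_exists)
  have fy: "(f, y) \<in> semidirect M G n"
    using fG y by (simp add: mem_semidirect)
  have "\<Psi> n (f, y) = \<Psi> n (f, 0) + umult y"
    by (simp add: Psi_def)
  then have Pv: "\<Psi> n (f, y) = x - D v"
    using y(2) by (simp add: r_def algebra_simps)
  \<comment> \<open>The differential of \<open>(f, y)\<close> has zero Lie component, and on the
    other component \<open>Psi\<close> is multiplication by u, hence injective.\<close>
  then have "\<Psi> (n + 1) (d\<^sub>\<zeta> n (f, y)) = 0"
    using Psi_chain[OF fy] M.CCu.d_d[OF v] xn by (simp add: M.D_diff)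
  then have "d\<^sub>\<zeta> n (f, y) = 0"
    using fG by (simp add: Psi_def semidirect_diff_def I_zero_left umult_eq_0_iff zero_prod_def)
  then have p: "(f, y) \<in> cocycles (semidirect M G) d\<^sub>\<zeta> n"
    using fy by (simp add: cocycles_def)
  have "x - \<Psi> n (f, y) = D v"
    by (simp add: Pv)
  then have "(x, \<Psi> n (f, y)) \<in> cohomologous (CC M) (\<lambda>_. D) n"
    using Psi_cocycle[OF p] M.CCu.coboundary[OF v] by (intro M.CCu.cohomologousI) simp_all
  then have "z = Psi_iso M b B \<iota> S \<zeta>h n (coh_class (semidirect M G) d\<^sub>\<zeta> n (f, y))"
    unfolding z Psi_iso_class[OF p] by (rule M.CCu.class_eqI)
  then show ?thesis
    using semidirect.class_in_cohomology[OF p] by blast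
qed

text \<open>By \<open>ev0_Psi\<close> and \<open>palladio_map_ev0\<close> the value at u = 0
  represents the dual of the Lie component; injectivity of duality lets \<open>inv_into\<close>
  recover that component.\<close>

lemma palladio_inverse_Psi:
  assumes p: "p \<in> cocycles (semidirect M G) d\<^sub>\<zeta> n"
  shows "inv_into (cohomology G (\<lambda>_. \<delta>) n) (palladio_iso M b \<iota> \<zeta> n)
      (connes_pi M b n (Psi_iso M b B \<iota> S \<zeta>h n (coh_class (semidirect M G) d\<^sub>\<zeta> n p)))
    = coh_class G (\<lambda>_. \<delta>) n (fst p)"
proof -
  note f = fst_cocycle[OF p]
  have "p \<in> semidirect M G n" using p by (simp add: cocycles_def)
  then have "connes_pi M b n (Psi_iso M b B \<iota> S \<zeta>h n (coh_class (semidirect M G) d\<^sub>\<zeta> n p))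
      = palladio_iso M b \<iota> \<zeta> n (coh_class G (\<lambda>_. \<delta>) n (fst p))"
    using M.Mb.class_eqI[OF palladio_map_ev0[OF f]]
    by (simp add: Psi_iso_class[OF p] M.connes_pi_class[OF Psi_cocycle[OF p]] ev0_Psi
        palladio_iso_class[OF f])
  moreover have "inj_on (palladio_iso M b \<iota> \<zeta> n) (cohomology G (\<lambda>_. \<delta>) n)"
    using palladio_map_qi
    by (simp add: quasi_isomorphism_def bij_betw_def palladio_iso_def)
  ultimately show ?thesis
    using g.class_in_cohomology[OF f] by simp
qed

section \<open>The bracket of two cocycles as a value of the connecting map\<close>

lemma Psi_bracket_class:
  assumes p: "p \<in> cocycles (semidirect M G) d\<^sub>\<zeta> m" and q: "q \<in> cocycles (semidirect M G) d\<^sub>\<zeta> n"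
  shows "coh_class (CC M) (\<lambda>_. D) (m + n) (\<Psi> (m + n) (semidirect_bracket br L m n p q)) =
    connes_beta M b B (m + n + 1) (coh_class M (\<lambda>_. b) (m + n + 1)
      (ksgn (m - 1) (palladio_map \<iota> \<zeta> (m + n + 1) (cup (fst p) (fst q)))))"
proof -
  obtain f x g y where pq: "p = (f, x)" "q = (g, y)" by (cases p, cases q)
  have fc: "f \<in> cocycles G (\<lambda>_. \<delta>) m" and gc: "g \<in> cocycles G (\<lambda>_. \<delta>) n"
    using fst_cocycle[OF p] fst_cocycle[OF q] by (simp_all add: pq)
  have f: "f \<in> G m" "\<delta> f = 0" and g: "g \<in> G n" "\<delta> g = 0"
    using fc gc by (auto simp: cocycles_def)
  define W where "W = \<Psi> n q"
  have W: "W \<in> CC M n" "D W = 0"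
    using Psi_cocycle[OF q] by (auto simp: W_def cocycles_def)
  have \<zeta>0: "ev0 \<zeta>h \<in> M (- 1)" using ev0_\<zeta>h by (auto simp: cohomologous_def cocycles_def)
  have "W (- 1) = 0" using CC_memD(2)[OF W(1)] by simp
  then have "ev0 (I f W) = \<iota> f (ev0 W)"
    by (simp add: ev0_def cartan_I_def uext_def umult_def ext_linear_simps)
  also have "ev0 W = palladio_map \<iota> (ev0 \<zeta>h) n g"
    using q ev0_Psi[of q n] by (simp add: W_def cocycles_def pq)
  \<comment> \<open>Here the sign of the theorem arises: \<open>ksgn n\<close> from the dual of
    \<open>g\<close> is split as \<open>ksgn (m - 1)\<close> times the sign
    \<open>ksgn (m + n + 1)\<close> in the dual of \<open>cup f g\<close>.\<close>
  also have "\<iota> f \<dots> = ksgn (m - 1) (palladio_map \<iota> (ev0 \<zeta>h) (m + n + 1) (cup f g))"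
    using \<iota>_cup[of f "m + 1" g "n + 1", OF _ _ \<zeta>0] f g
    by (simp add: shift_def palladio_map_def ksgn_def ext_linear_simps)
  finally have "(ev0 (I f W), ksgn (m - 1) (palladio_map \<iota> \<zeta> (m + n + 1) (cup f g)))
      \<in> cohomologous M (\<lambda>_. b) (m + n + 1)"
    using M.Mb.cohomologous_ksgn[OF palladio_map_ev0[OF cup_cocycle[OF fc gc]]] by simp
  then have ev: "ev0 (I f W) \<in> coh_class M (\<lambda>_. b) (m + n + 1)
      (ksgn (m - 1) (palladio_map \<iota> \<zeta> (m + n + 1) (cup f g)))"
    using M.Mb.cohomologous_sym by (simp add: coh_class_def)
  have "D (I f W) = umult (uext (L f) W)"
    using D_I[OF f(1) W(1)] W(2) f(2) by (simp add: I_zero I_zero_left)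
  note beta = M.connes_beta_eqI[OF I_closed[OF f(1) W(1)] ev this]
  have LW: "uext (L f) W \<in> CC M (m + n)" by (rule L_closed[OF f(1) W(1)])
  moreover have "D (uext (L f) W) = 0"
    using D_L[OF f(1) W(1)] W(2) f(2) by (simp add: L_zero L_zero_left)
  ultimately have LWc: "uext (L f) W \<in> cocycles (CC M) (\<lambda>_. D) (m + n)"
    by (simp add: cocycles_def)
  have "x \<in> CC M (m - 2)" using p by (simp add: pq cocycles_def mem_semidirect)
  then obtain v where "v \<in> CC M (m + n - 1)"
    "\<Psi> (m + n) (semidirect_bracket br L m n p q) = uext (L f) W - ksgn (m * n) (D v)"
    using Psi_bracket[OF p[unfolded pq] q[unfolded pq]] bracket_homotopy_closed[OF f(1) _ g(1)]
    by (auto simp: pq W_def)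
  then have "\<Psi> (m + n) (semidirect_bracket br L m n p q) - uext (L f) W
      \<in> coboundaries (CC M) (\<lambda>_. D) (m + n)"
    using M.CCu.coboundary_neg[OF M.CCu.coboundary_ksgn[OF M.CCu.coboundary]] by simp
  then have "coh_class (CC M) (\<lambda>_. D) (m + n) (\<Psi> (m + n) (semidirect_bracket br L m n p q))
      = coh_class (CC M) (\<lambda>_. D) (m + n) (uext (L f) W)"
    by (intro M.CCu.class_eqI M.CCu.cohomologousI LWc)
  then show ?thesis using beta LW by (simp add: pq)
qed

section \<open>The formula on cohomology\<close>

theorem bracket_eq_beta_cup:
  assumes z: "z \<in> HC M b B m" and w: "w \<in> HC M b B n"
  shows "HC_bracket M b B G \<delta> br \<iota> L S \<zeta>h m n z w =
    HC_sign M b B (m + n) (m - 1)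
      (connes_beta M b B (m + n + 1)
        (palladio_cup M b G \<delta> \<iota> cup \<zeta> m n (connes_pi M b m z) (connes_pi M b n w)))"
    (is "_ = ?R")
proof -
  let ?H = "cohomology (semidirect M G) d\<^sub>\<zeta>" and ?\<Psi> = "Psi_iso M b B \<iota> S \<zeta>h"
  define X where "X = inv_into (?H m) (?\<Psi> m) z"
  define Y where "Y = inv_into (?H n) (?\<Psi> n) w"
  have X: "X \<in> ?H m" "?\<Psi> m X = z" and Y: "Y \<in> ?H n" "?\<Psi> n Y = w"
    using Psi_iso_surj[OF z] Psi_iso_surj[OF w]
    by (auto simp: X_def Y_def inv_into_into f_inv_into_f)
  \<comment> \<open>The value is shown for arbitrary representatives, so the unions hidden in
    \<open>HC_bracket\<close> are constant.\<close>
  have R: "coh_class (CC M) (\<lambda>_. D) (m + n) (\<Psi> (m + n) (semidirect_bracket br L m n p q)) = ?R"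
    if pX: "p \<in> X" and qY: "q \<in> Y" for p q
  proof -
    note p = semidirect.mem_cohomologyD[OF X(1) pX] and q = semidirect.mem_cohomologyD[OF Y(1) qY]
    note f = fst_cocycle[OF p(1)] and g = fst_cocycle[OF q(1)]
    have inv: "inv_into (cohomology G (\<lambda>_. \<delta>) m) (palladio_iso M b \<iota> \<zeta> m) (connes_pi M b m z)
          = coh_class G (\<lambda>_. \<delta>) m (fst p)"
      "inv_into (cohomology G (\<lambda>_. \<delta>) n) (palladio_iso M b \<iota> \<zeta> n) (connes_pi M b n w)
          = coh_class G (\<lambda>_. \<delta>) n (fst q)"
      using palladio_inverse_Psi[OF p(1)] palladio_inverse_Psi[OF q(1)] X(2) Y(2) p(2) q(2) by simp_all
    have "coh_map2 G (\<lambda>_. \<delta>) (m + n + 1) cup (coh_class G (\<lambda>_. \<delta>) m (fst p)) (coh_class G (\<lambda>_. \<delta>) n (fst q))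
        = coh_class G (\<lambda>_. \<delta>) (m + n + 1) (cup (fst p) (fst q))"
      unfolding coh_map2_def
      by (rule coh_map2_class[OF g.cochain_complex_axioms g.cochain_complex_axioms
            g.cochain_complex_axioms cup_cohomologous f g])
    then have "palladio_cup M b G \<delta> \<iota> cup \<zeta> m n (connes_pi M b m z) (connes_pi M b n w)
        = coh_class M (\<lambda>_. b) (m + n + 1) (palladio_map \<iota> \<zeta> (m + n + 1) (cup (fst p) (fst q)))"
      by (simp add: palladio_cup_def inv palladio_iso_class cup_cocycle[OF f g])
    moreover have "palladio_map \<iota> \<zeta> (m + n + 1) (cup (fst p) (fst q)) \<in> cocycles M (\<lambda>_. b) (m + n + 1)"
      using palladio_map_ev0[OF cup_cocycle[OF f g]] by (auto simp: cohomologous_def)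
    ultimately show ?thesis
      by (simp add: Psi_bracket_class[OF p(1) q(1)] M.HC_sign_connes_beta)
  qed
  \<comment> \<open>The outer union runs over all cocycles \<open>r\<close> in the class of the
    bracket, not just the bracket itself.\<close>
  have "coh_class (CC M) (\<lambda>_. D) (m + n) (\<Psi> (m + n) r) = ?R"
    if "p \<in> X" "q \<in> Y" "r \<in> coh_class (semidirect M G) d\<^sub>\<zeta> (m + n) (semidirect_bracket br L m n p q)"
    for p q r
    using M.CCu.class_eqI[OF Psi_cohomologous[OF semidirect.mem_classD(1)[OF that(3)]]] R[OF that(1,2)]
    by simp
  then have "coh_class (CC M) (\<lambda>_. D) (m + n) (\<Psi> (m + n) r) = ?R"
    if "r \<in> coh_map2 (semidirect M G) d\<^sub>\<zeta> (m + n) (semidirect_bracket br L m n) X Y" for r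
    using that unfolding coh_map2_def by blast
  \<comment> \<open>An empty index set would make the union empty; \<open>bracket_cocycle\<close>
    excludes this by placing the bracket in its own class.\<close>
  moreover have "coh_map2 (semidirect M G) d\<^sub>\<zeta> (m + n) (semidirect_bracket br L m n) X Y \<noteq> {}"
  proof -
    obtain p q where pq: "p \<in> X" "q \<in> Y"
      using semidirect.cohomology_nonempty[OF X(1)] semidirect.cohomology_nonempty[OF Y(1)] by blast
    then have "semidirect_bracket br L m n p q
        \<in> coh_class (semidirect M G) d\<^sub>\<zeta> (m + n) (semidirect_bracket br L m n p q)"
      using X(1) Y(1) by (intro semidirect.in_own_class bracket_cocycle semidirect.mem_cohomologyD(1))
    with pq show ?thesis unfolding coh_map2_def by blast
  qed
  ultimately have "?\<Psi> (m + n) (coh_map2 (semidirect M G) d\<^sub>\<zeta> (m + n) (semidirect_bracket br L m n) X Y) = ?R"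
    unfolding Psi_iso_def coh_map_def by (intro SUP_eq_const)
  then show ?thesis by (simp add: HC_bracket_def Let_def X_def Y_def)
qed

end

theorem theoremA:
  fixes scaleM :: "'k::field_char_0 \<Rightarrow> 'm::ab_group_add \<Rightarrow> 'm"
    and scaleG :: "'k \<Rightarrow> 'g::ab_group_add \<Rightarrow> 'g"
    and M :: "int \<Rightarrow> 'm set" and b B :: "'m \<Rightarrow> 'm"
    and G :: "int \<Rightarrow> 'g set" and \<delta> :: "'g \<Rightarrow> 'g" and br cup :: "'g \<Rightarrow> 'g \<Rightarrow> 'g" and e :: 'g
    and \<iota> L S :: "'g \<Rightarrow> 'm \<Rightarrow> 'm" and T :: "'g \<Rightarrow> 'g \<Rightarrow> 'm \<Rightarrow> 'm"
    and \<zeta> :: 'm and \<zeta>h :: "int \<Rightarrow> 'm"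
    and z w :: "(int \<Rightarrow> 'm) set" and m n :: int
  assumes "homotopy_cartan_gerstenhaber_calculus scaleM M b B scaleG G \<delta> br \<iota> L S T cup e"
    and "palladio_cocycle M b B G \<delta> \<iota> \<zeta>"
    and "\<zeta>h \<in> cocycles (CC M) (\<lambda>_. du b B) (- 1)"
    and "(ev0 \<zeta>h, \<zeta>) \<in> cohomologous M (\<lambda>_. b) (- 1)"
    and "z \<in> HC M b B m" and "w \<in> HC M b B n"
  shows "HC_bracket M b B G \<delta> br \<iota> L S \<zeta>h m n z w =
    HC_sign M b B (m + n) (m - 1)
      (connes_beta M b B (m + n + 1)
        (palladio_cup M b G \<delta> \<iota> cup \<zeta> m n (connes_pi M b m z) (connes_pi M b n w)))"
proof -
  interpret homotopy_cartan_gerstenhaber_calculus scaleM M b B scaleG G \<delta> br \<iota> L S T cup e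
    by fact
  interpret palladio_calculus scaleM M b B scaleG G \<delta> br \<iota> L S T cup e \<zeta>h \<zeta>
    using assms by unfold_locales
  show ?thesis using assms by (intro bracket_eq_beta_cup)
qed

end
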